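(* Suppose the distributions of the inputs $\bm{S}(\bm{x},c_i)$ are unknown, and that in Algorithms 1 and 2 (described in the context) the acquisition function is computed with working densities $\hat g_t(\cdot\mid\bm{x},c_i)$ in place of the true densities, while the evaluated points are still sampled from the true $\bm{S}(\bm{x},c_i)$. The working densities may be the Bayesian estimates $g_t$ described in the context, or estimates that do not converge to the true input distributions, or misspecified densities used without estimation. Let $h\in\mathbb{R}$, $\epsilon>0$, $\beta>0$, and consider the conditions (A1) $\sum_{t=1}^\infty p_t=\infty$; (A1') there exists $p^*\in(0,1)$ with $p^*\le p_t$ for every $t\in\mathbb{N}$; (A2) for every $\bm{x}\in\Omega$ and $\eta>0$ there exist $\bm{x}'\in\Omega$ and a cost $c_i$ with $\mathrm{P}(\bm{S}(\bm{x}',c_i)\in\mathscr{N}(\bm{x};\eta))>0$, where $\mathscr{N}(\bm{x};\eta)=\{\bm{a}\in D:\|\bm{a}-\bm{x}\|<\eta\}$; (A3) for every $\bm{x}\in\Omega$, $k$ is continuous at $(\bm{x},\bm{x})$. Then all of the following hold. (i) Under (A1)–(A3), if the trials of Algorithm 1 are continued forever without applying the termination condition, then with probability 1, $\sigma_t^2(\bm{x})\to0$ as $t\to\infty$ for every $\bm{x}\in\Omega$; and with probability 1 the number of evaluations required to complete Algorithm 1 is finite. For (ii)–(iii) let $\delta\in(0,1)$, let $T^*$ be the smallest positive integer with $T^*>2\beta\sigma^2\epsilon^{-2}$, let $\nu>0$ be such that $|\varsigma^2_{T^*}(\bm{x})-\varsigma^2_{\bm{a}^{(T^* )}}(\bm{x})|<\epsilon^2/(2\beta)$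 for all $\bm{x}\in\Omega$ and all $\bm{a}^{(T^* )}\in\mathscr{N}(\bm{x};\nu)^{T^*}$, where $\varsigma^2=\varsigma^2[\sigma^2]$, and let $\tilde p^*=\min_{\bm{x}\in\Omega}\sum_{\bm{a}\in\Omega}\sum_{i=1}^K\kappa_i\mathrm{P}(\bm{S}(\bm{a},c_i)\in\mathscr{N}(\bm{x};\nu))$, which is positive. (ii) Under (A1)–(A3), there exist integers $0=N_0<N_1<\dots<N_{|\Omega|T^*}$ with $\prod_{t=N_{j-1}+1}^{N_j}(1-p_t\tilde p^* )<\delta/(|\Omega|T^* )$ for all $j\in\{1,\dots,|\Omega|T^*\}$; and for such integers, with probability at least $1-\delta$, Algorithm 1 completes after at most $N_{|\Omega|T^*}$ trials. (iii) Under (A1'), (A2), (A3), let $p=p^*\tilde p^*$ and let $r$ be the smallest positive integer with $r>\log(|\Omega|T^*\delta^{-1})/(-\log(1-p))$. Then with probability at least $1-\delta$, Algorithm 1 completes after at most $r|\Omega|T^*$ trials. For (iv)–(v) let $\tilde\delta\in(0,1)$, $\tilde\sigma^2=\max\{\sigma^{(1)2},\dots,\sigma^{(k^* )2}\}$, let $\tilde T^*$ be the smallest positive integer with $\tilde T^*>2\beta\tilde\sigma^2\epsilon^{-2}$, let $\tilde\nu>0$ be such that $|\tilde\varsigma^2_{\tilde T^*}(\bm{x})-\tilde\varsigma^2_{\bm{a}^{(\tilde T^* )}}(\bm{x})|<\epsilon^2/(2\beta)$ for all $\bm{x}\in\Omega$ and all $\bm{a}^{(\tilde T^* )}\in\mathscr{N}(\bm{x};\tilde\nu)^{\tilde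 T^*}$, where $\tilde\varsigma^2=\varsigma^2[\tilde\sigma^2]$, and let $\hat p^*=\min_{\bm{x}\in\Omega}\sum_{\bm{a}\in\Omega}\sum_{i=1}^K\big(\sum_{j=1}^{k^*}\kappa_{i,j}\big)\mathrm{P}(\bm{S}(\bm{a},c_i)\in\mathscr{N}(\bm{x};\tilde\nu))$, which is positive. (iv) Under (A1)–(A3), there exist integers $0=\tilde N_0<\tilde N_1<\dots<\tilde N_{|\Omega|\tilde T^*}$ with $\prod_{t=\tilde N_{j-1}+1}^{\tilde N_j}(1-p_t\hat p^* )<\tilde\delta/(|\Omega|\tilde T^* )$ for all $j\in\{1,\dots,|\Omega|\tilde T^*\}$; and for such integers, with probability at least $1-\tilde\delta$, Algorithm 2 completes after at most $\tilde N_{|\Omega|\tilde T^*}$ trials. (v) Under (A1'), (A2), (A3), let $\hat p=p^*\hat p^*$ and let $\tilde r$ be the smallest positive integer with $\tilde r>\log(|\Omega|\tilde T^*\tilde\delta^{-1})/(-\log(1-\hat p))$. Then with probability at least $1-\tilde\delta$, Algorithm 2 completes after at most $\tilde r|\Omega|\tilde T^*$ trials.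
   Context: Setting. $D\subset\mathbb{R}^d$, $\Omega\subset D$ is a nonempty finite set, and $f:D\to\mathbb{R}$ is a black-box function modelled with a Gaussian process prior $\mathcal{GP}(0,k)$ with positive-definite kernel $k:D\times D\to\mathbb{R}$. There are input costs $0<c_1<\dots<c_K$ and output costs $0<c^{(\mathrm{out})}_1<\dots<c^{(\mathrm{out})}_{k^*}$. If the point $\bm{x}\in\Omega$ is requested with input cost $c_i$, the point actually evaluated is a random sample $\bm{s}\in D$ of a random variable $\bm{S}(\bm{x},c_i)$. One observes $\bm{s}$ and $y=f(\bm{s})+$ independent Gaussian noise of mean zero; for Algorithm 1 the noise variance is a constant $\sigma^2>0$ (no output costs), and for Algorithm 2 it is $\sigma^{(o)2}>0$ when output cost $c^{(\mathrm{out})}_o$ is used. Posterior. After $t$ trials with evaluated points $\bm{s}_1,\dots,\bm{s}_t$ and observations $\bm{y}_t=(y_1,\dots,y_t)^\top$, put $\bm{k}_t(\bm{x})=(k(\bm{s}_1,\bm{x}),\dots,k(\bm{s}_t,\bm{x}))^\top$, $\bm{K}_t=(k(\bm{s}_i,\bm{s}_j))_{i,j}$, $\bm{C}_t=\bm{K}_t+\bm{\Sigma}_t$, where $\bm{\Sigma}_t$ is the diagonal matrix of the noise variances of the $t$ observations ($\sigma^2\bm{I}_t$ for Algorithm 1), and $\mu_t(\bm{x})=\bm{k}_t(\bm{x})^\top\bm{C}_t^{-1}\bm{y}_t$, $k_t(\bm{x},\bm{x}')=k(\bm{x},\bm{x}')-\bm{k}_t(\bm{x})^\top\bm{C}_t^{-1}\bm{k}_t(\bm{x}')$,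 $\sigma_t^2(\bm{x})=k_t(\bm{x},\bm{x})$. (If a finite, possibly empty, set of initial training data from the same observation model is supplied, it is included in the conditioning as well.) Classification. Let $l_t(\bm{x})=\mu_t(\bm{x})-\beta^{1/2}\sigma_t(\bm{x})$, $u_t(\bm{x})=\mu_t(\bm{x})+\beta^{1/2}\sigma_t(\bm{x})$, and $H_t=\{\bm{x}\in\Omega: l_t(\bm{x})>h-\epsilon\}$, $L_t=\{\bm{x}\in\Omega: u_t(\bm{x})<h+\epsilon\}$, $U_t=\Omega\setminus(H_t\cup L_t)$ for $t\ge1$, with $U_0=\Omega$. Working densities. For each $t$, $\bm{x}\in\Omega$ and $i$, $\hat g_t(\cdot\mid\bm{x},c_i)$ is a probability density on $D$ determined by the data collected so far (possibly fixed in advance), used in place of the unknown density of $\bm{S}(\bm{x},c_i)$. The Bayesian estimate is: the density is assumed of known form $g(\bm{s}\mid\theta_{\bm{x}}^{(c_i)})$ with $\theta_{\bm{x}}^{(c_i)}=(\tilde\theta_{\bm{x}}^{(c_i)},\xi^{(c_i)})$, $\tilde\theta_{\bm{x}}^{(c_i)}$ known and $\xi^{(c_i)}$ unknown with a prior $\pi$; with $\pi_t$ the posterior of $\xi^{(c_i)}$ given the data, $g_t(\bm{s}\mid\theta_{\bm{x}}^{(c_i)})=\int g(\bm{s}\mid\theta_{\bm{x}}^{(c_i)})\,\pi_t(\xi^{(c_i)})\,d\xi^{(c_i)}$. Acquisition functions. For a hypothetical new data point $(\bm{s}^*,y^* )$, let $HL_t(\bm{s}^*,y^* )$ be the union of the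 two estimated sets recomputed after adding it to the current data, and $HL_t=H_t\cup L_t$. For Algorithm 1, $a_t(\bm{x},c_i)=c_i^{-1}\big\{\int \mathrm{E}_{y^*}[|HL_t(\bm{s}^*,y^* )|]\,\hat g_t(\bm{s}^*\mid\bm{x},c_i)\,d\bm{s}^*-|HL_t|\big\}$ with $y^*\sim\mathcal{N}(\mu_t(\bm{s}^* ),\sigma_t^2(\bm{s}^* )+\sigma^2)$. For Algorithm 2, $a_t(\bm{x},c_i,c^{(\mathrm{out})}_o)$ is the same expression with $c_i^{-1}$ replaced by $(c_i+c^{(\mathrm{out})}_o)^{-1}$ and $\sigma^2$ replaced by $\sigma^{(o)2}$ (the noise variance attached to the new data point). Algorithm 1. Given $p_1,p_2,\dots\in[0,1]$ and $\kappa_1,\dots,\kappa_K\in(0,1)$ with $|\Omega|\sum_{i=1}^K\kappa_i=1$. As long as $U_{t-1}\neq\emptyset$, trial $t$ is performed: draw independently $r_t\sim$ Bernoulli$(p_t)$; if $r_t=0$ choose $(\bm{x}_t,c_{i_t})$ maximizing the acquisition function (computed from the current data) over $\Omega\times\{c_1,\dots,c_K\}$; if $r_t=1$ draw $(\bm{x}_t,c_{i_t})=C_t$, where, independently of everything else, $\mathrm{P}(C_t=(\bm{x},c_i))=\kappa_i$ for each $\bm{x}\in\Omega$ and each $i$. Then sample $\bm{s}_t$ from the true $\bm{S}(\bm{x}_t,c_{i_t})$ (independently of the past given the choice), observe $y_t$, and update. Algorithm 2. The same, except that triples $(\bm{x}_t,c_{i_t},c^{(\mathrm{out})}_{j_t})$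 are chosen: by maximizing $a_t(\bm{x},c_i,c^{(\mathrm{out})}_j)$ if $r_t=0$, and if $r_t=1$ at random, independently of everything else, with each triple $(\bm{x},c_i,c^{(\mathrm{out})}_j)$ having probability $\kappa_{i,j}\in(0,1)$, $|\Omega|\sum_{i,j}\kappa_{i,j}=1$; the noise variance in trial $t$ is $\sigma^{(j_t)2}$. Either algorithm completes after $t$ trials if $t$ is the first index with $U_t=\emptyset$. Auxiliary variances. For $v>0$, $t\ge1$, $\bm{x}\in\Omega$, with $\bm{1}_t$ the all-ones vector, $\varsigma^2[v]_t(\bm{x})=k(\bm{x},\bm{x})-(k(\bm{x},\bm{x})\bm{1}_t)^\top(k(\bm{x},\bm{x})\bm{1}_t\bm{1}_t^\top+v\bm{I}_t)^{-1}(k(\bm{x},\bm{x})\bm{1}_t)$, and for a tuple $\bm{x}^{(t)}=(\bm{x}_1,\dots,\bm{x}_t)$ of points of $D$, $\varsigma^2[v]_{\bm{x}^{(t)}}(\bm{x})=k(\bm{x},\bm{x})-\bm{k}_{\bm{x}^{(t)}}(\bm{x})^\top(\bm{K}_{\bm{x}^{(t)}}+v\bm{I}_t)^{-1}\bm{k}_{\bm{x}^{(t)}}(\bm{x})$, where $\bm{k}_{\bm{x}^{(t)}}(\bm{x})$ has $i$th entry $k(\bm{x}_i,\bm{x})$ and $\bm{K}_{\bm{x}^{(t)}}$ has $(i,j)$ entry $k(\bm{x}_i,\bm{x}_j)$. Write $\varsigma^2=\varsigma^2[\sigma^2]$ and $\tilde\varsigma^2=\varsigma^2[\tilde\sigma^2]$.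 *)

theory Defs
  imports
    "HOL-Probability.Probability"
    "Jordan_Normal_Form.Gauss_Jordan_Elimination"
begin

section \<open>Gaussian process regression\<close>

definition pos_def_kernel :: "'a set \<Rightarrow> ('a \<Rightarrow> 'a \<Rightarrow> real) \<Rightarrow> bool" where
  "pos_def_kernel D k \<longleftrightarrow>
     (\<forall>x\<in>D. \<forall>y\<in>D. k x y = k y x) \<and>
     (\<forall>X a. finite X \<and> X \<subseteq> D \<longrightarrow> 0 \<le> (\<Sum>x\<in>X. \<Sum>y\<in>X. a x * a y * k x y))"

definition kernel_vec :: "('a \<Rightarrow> 'a \<Rightarrow> real) \<Rightarrow> 'a list \<Rightarrow> 'a \<Rightarrow> real vec" where
  "kernel_vec k ss x = vec (length ss) (\<lambda>i. k (ss ! i) x)"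

definition kernel_mat :: "('a \<Rightarrow> 'a \<Rightarrow> real) \<Rightarrow> 'a list \<Rightarrow> real mat" where
  "kernel_mat k ss = mat (length ss) (length ss) (\<lambda>(i, j). k (ss ! i) (ss ! j))"

text \<open>
  For a positive definite kernel and positive noise variances the matrices inverted below are
  positive definite, so that \<^term>\<open>mat_inverse\<close> never returns \<^term>\<open>None\<close> on them.
\<close>

definition gp_gain :: "('a \<Rightarrow> 'a \<Rightarrow> real) \<Rightarrow> 'a list \<Rightarrow> real list \<Rightarrow> real mat" where
  "gp_gain k ss vs = the (mat_inverse (kernel_mat k ss + mat_diag (length ss) (\<lambda>i. vs ! i)))"

definition gp_mean :: "('a \<Rightarrow> 'a \<Rightarrow> real) \<Rightarrow> 'a list \<Rightarrow> real list \<Rightarrow> real list \<Rightarrow> 'a \<Rightarrow> real" where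
  "gp_mean k ss vs ys x = kernel_vec k ss x \<bullet> (gp_gain k ss vs *\<^sub>v vec_of_list ys)"

definition gp_cov :: "('a \<Rightarrow> 'a \<Rightarrow> real) \<Rightarrow> 'a list \<Rightarrow> real list \<Rightarrow> 'a \<Rightarrow> 'a \<Rightarrow> real" where
  "gp_cov k ss vs x x' = k x x' - kernel_vec k ss x \<bullet> (gp_gain k ss vs *\<^sub>v kernel_vec k ss x')"

definition tuple_var :: "('a \<Rightarrow> 'a \<Rightarrow> real) \<Rightarrow> real \<Rightarrow> 'a list \<Rightarrow> 'a \<Rightarrow> real" where
  "tuple_var k v as x = gp_cov k as (replicate (length as) v) x x"

definition repeat_var :: "('a \<Rightarrow> 'a \<Rightarrow> real) \<Rightarrow> real \<Rightarrow> nat \<Rightarrow> 'a \<Rightarrow> real" where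
  "repeat_var k v t x =
     (let u = vec t (\<lambda>_. k x x);
          C = mat t t (\<lambda>_. k x x) + v \<cdot>\<^sub>m 1\<^sub>m t
      in k x x - u \<bullet> (the (mat_inverse C) *\<^sub>v u))"


section \<open>Data and classification\<close>

text \<open>
  A data point records the request \<open>q\<close> that was made, the point \<open>s\<close> that was actually evaluated
  and the observation \<open>y\<close>.  A request is a pair (point of \<open>\<Omega>\<close>, index of input cost) in
  the algorithm without output costs and a triple that also contains the index of the output cost in
  the other one; the function \<open>v\<close> assigns to a request the variance of the observation noise.
\<close>

type_synonym ('q, 'a) data = "('q \<times> 'a \<times> real) list"

definition post_mean ::
    "('a \<Rightarrow> 'a \<Rightarrow> real) \<Rightarrow> ('q \<Rightarrow> real) \<Rightarrow> ('q, 'a) data \<Rightarrow> 'a \<Rightarrow> real" where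
  "post_mean k v d x =
     gp_mean k (map (\<lambda>(q, s, y). s) d) (map (\<lambda>(q, s, y). v q) d) (map (\<lambda>(q, s, y). y) d) x"

definition post_var ::
    "('a \<Rightarrow> 'a \<Rightarrow> real) \<Rightarrow> ('q \<Rightarrow> real) \<Rightarrow> ('q, 'a) data \<Rightarrow> 'a \<Rightarrow> real" where
  "post_var k v d x =
     gp_cov k (map (\<lambda>(q, s, y). s) d) (map (\<lambda>(q, s, y). v q) d) x x"

record 'a level_set_problem =
  inputs :: "'a set"
  cand :: "'a set"
  ker :: "'a \<Rightarrow> 'a \<Rightarrow> real"
  thr :: real
  marg :: real
  conf :: real

definition level_set_problem :: "'a set \<Rightarrow> 'a set \<Rightarrow> ('a \<Rightarrow> 'a \<Rightarrow> real) \<Rightarrow> real \<Rightarrow> real \<Rightarrow> real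
    \<Rightarrow> 'a level_set_problem" where
  "level_set_problem D \<Omega> k h \<epsilon> \<beta> =
     \<lparr>inputs = D, cand = \<Omega>, ker = k, thr = h, marg = \<epsilon>, conf = \<beta>\<rparr>"

definition high_set :: "'a level_set_problem \<Rightarrow> ('q \<Rightarrow> real) \<Rightarrow> ('q, 'a) data \<Rightarrow> 'a set" where
  "high_set P v d = {x \<in> cand P.
     post_mean (ker P) v d x - sqrt (conf P) * sqrt (post_var (ker P) v d x) > thr P - marg P}"

definition low_set :: "'a level_set_problem \<Rightarrow> ('q \<Rightarrow> real) \<Rightarrow> ('q, 'a) data \<Rightarrow> 'a set" where
  "low_set P v d = {x \<in> cand P.
     post_mean (ker P) v d x + sqrt (conf P) * sqrt (post_var (ker P) v d x) < thr P + marg P}"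

text \<open>
  The argument \<open>t\<close> is the number of trials performed; \<open>d\<close> are the data available then.  Before the
  first trial every candidate counts as unclassified, whatever the initial data are.
\<close>

definition classified ::
    "'a level_set_problem \<Rightarrow> ('q \<Rightarrow> real) \<Rightarrow> nat \<Rightarrow> ('q, 'a) data \<Rightarrow> 'a set" where
  "classified P v t d = (if t = 0 then {} else high_set P v d \<union> low_set P v d)"

definition unclassified ::
    "'a level_set_problem \<Rightarrow> ('q \<Rightarrow> real) \<Rightarrow> nat \<Rightarrow> ('q, 'a) data \<Rightarrow> 'a set" where
  "unclassified P v t d = cand P - classified P v t d"


section \<open>Working densities\<close>

definition prob_density_on :: "'a::euclidean_space set \<Rightarrow> ('a \<Rightarrow> real) \<Rightarrow> bool" where
  "prob_density_on D g \<longleftrightarrow>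
     (\<forall>s. 0 \<le> g s) \<and> (\<forall>s. s \<notin> D \<longrightarrow> g s = 0) \<and> has_bochner_integral lborel g 1"

text \<open>
  The Bayesian estimate.  The density of the evaluated point for the request \<open>(x, i)\<close> is
  \<open>g (\<theta> x i) \<xi>\<close> with known \<open>\<theta> x i\<close> and unknown \<open>\<xi>\<close>, which has the prior density \<open>prior i\<close> with respect
  to \<open>\<Xi>\<close>.  The list \<open>obs\<close> contains the entries \<open>((x, i), s)\<close> observed so far; only those with the
  same input cost index are informative about \<open>\<xi>\<close>.
\<close>

definition bayes_weight ::
    "(nat \<Rightarrow> 'x \<Rightarrow> real) \<Rightarrow> ('th \<Rightarrow> 'x \<Rightarrow> 'a \<Rightarrow> real) \<Rightarrow> ('a \<Rightarrow> nat \<Rightarrow> 'th)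
      \<Rightarrow> (('a \<times> nat) \<times> 'a) list \<Rightarrow> nat \<Rightarrow> 'x \<Rightarrow> real" where
  "bayes_weight prior g \<theta> obs i \<xi> =
     prior i \<xi> * (\<Prod>((x, i'), s) \<leftarrow> filter (\<lambda>((x, i'), s). i' = i) obs. g (\<theta> x i) \<xi> s)"

definition bayes_posterior ::
    "'x measure \<Rightarrow> (nat \<Rightarrow> 'x \<Rightarrow> real) \<Rightarrow> ('th \<Rightarrow> 'x \<Rightarrow> 'a \<Rightarrow> real) \<Rightarrow> ('a \<Rightarrow> nat \<Rightarrow> 'th)
      \<Rightarrow> (('a \<times> nat) \<times> 'a) list \<Rightarrow> nat \<Rightarrow> 'x \<Rightarrow> real" where
  "bayes_posterior \<Xi> prior g \<theta> obs i \<xi> =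
     bayes_weight prior g \<theta> obs i \<xi> / (LINT \<xi>'|\<Xi>. bayes_weight prior g \<theta> obs i \<xi>')"

definition bayes_estimate ::
    "'x measure \<Rightarrow> (nat \<Rightarrow> 'x \<Rightarrow> real) \<Rightarrow> ('th \<Rightarrow> 'x \<Rightarrow> 'a \<Rightarrow> real) \<Rightarrow> ('a \<Rightarrow> nat \<Rightarrow> 'th)
      \<Rightarrow> (('a \<times> nat) \<times> 'a) list \<Rightarrow> 'a \<Rightarrow> nat \<Rightarrow> 'a \<Rightarrow> real" where
  "bayes_estimate \<Xi> prior g \<theta> obs x i s =
     (LINT \<xi>|\<Xi>. g (\<theta> x i) \<xi> s * bayes_posterior \<Xi> prior g \<theta> obs i \<xi>)"

text \<open>Whenever the posterior exists, the Bayesian estimate is an admissible working density.\<close>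

lemma prob_density_on_bayes_estimate:
  fixes D :: "'a::euclidean_space set" and \<Xi> :: "'x measure"
  assumes sf: "sigma_finite_measure \<Xi>"
    and meas: "(\<lambda>(\<xi>, s). g (\<theta> x i) \<xi> s) \<in> borel_measurable (\<Xi> \<Otimes>\<^sub>M lborel)"
    and dens: "\<And>\<tau> \<xi>. prob_density_on D (g \<tau> \<xi>)"
    and prior: "\<And>\<xi>. 0 \<le> prior i \<xi>"
    and int: "integrable \<Xi> (bayes_weight prior g \<theta> obs i)"
    and ev: "(LINT \<xi>|\<Xi>. bayes_weight prior g \<theta> obs i \<xi>) > 0"
  shows "prob_density_on D (bayes_estimate \<Xi> prior g \<theta> obs x i)"
proof -
  interpret \<Xi>: sigma_finite_measure \<Xi> by fact
  interpret pair_sigma_finite \<Xi> "lborel :: 'a measure" ..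
  let ?p = "bayes_posterior \<Xi> prior g \<theta> obs i"
  have nn: "0 \<le> g \<tau> \<xi> s" and out: "s \<notin> D \<Longrightarrow> g \<tau> \<xi> s = 0"
    and intg: "integrable lborel (g \<tau> \<xi>)" and one: "(LINT s|lborel. g \<tau> \<xi> s) = 1" for \<tau> \<xi> s
    using dens[of \<tau> \<xi>] by (auto simp: prob_density_on_def has_bochner_integral_iff)
  have wnn: "0 \<le> bayes_weight prior g \<theta> obs i \<xi>" for \<xi>
    unfolding bayes_weight_def
    by (intro mult_nonneg_nonneg prior prod_list_nonneg) (auto simp: nn)
  have pnn: "0 \<le> ?p \<xi>" for \<xi>
    unfolding bayes_posterior_def using wnn ev by (intro divide_nonneg_pos) auto
  have pint: "integrable \<Xi> ?p"
    unfolding bayes_posterior_def by (intro integrable_divide int)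
  have pone: "(LINT \<xi>|\<Xi>. ?p \<xi>) = 1"
    unfolding bayes_posterior_def using ev by simp
  have [measurable]: "?p \<in> borel_measurable \<Xi>" using pint by auto
  note meas[measurable]
  let ?F = "\<lambda>(\<xi>, s). g (\<theta> x i) \<xi> s * ?p \<xi>"
  have Fm: "?F \<in> borel_measurable (\<Xi> \<Otimes>\<^sub>M lborel)"
  proof -
    have "?F = (\<lambda>z. (case z of (\<xi>, s) \<Rightarrow> g (\<theta> x i) \<xi> s) * ?p (fst z))"
      by (auto simp: fun_eq_iff)
    also have "\<dots> \<in> borel_measurable (\<Xi> \<Otimes>\<^sub>M lborel)" by measurable
    finally show ?thesis .
  qed
  have Fint: "integrable (\<Xi> \<Otimes>\<^sub>M lborel) ?F"
    by (rule Fubini_integrable[OF Fm]) (auto simp: nn pnn one pint intg abs_mult)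
  have "has_bochner_integral lborel (\<lambda>s. LINT \<xi>|\<Xi>. g (\<theta> x i) \<xi> s * ?p \<xi>) 1"
    unfolding has_bochner_integral_iff
  proof
    show "integrable lborel (\<lambda>s. LINT \<xi>|\<Xi>. g (\<theta> x i) \<xi> s * ?p \<xi>)"
      using integrable_snd[OF Fint] by simp
    show "(LINT s|lborel. LINT \<xi>|\<Xi>. g (\<theta> x i) \<xi> s * ?p \<xi>) = 1"
      using Fubini_integral[OF Fint] by (simp add: one pone)
  qed
  then show ?thesis
    unfolding prob_density_on_def bayes_estimate_def
    by (auto intro!: Bochner_Integration.integral_nonneg mult_nonneg_nonneg nn pnn simp: out)
qed


section \<open>The algorithms\<close>

text \<open>
  The part of the description that differs between the two algorithms: the set of possible requests,
  and for each request the noise variance, the cost, the true law of the evaluated point, the working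
  density (given the number of trials and the data) and the probability of being drawn when \<open>r\<^sub>t = 1\<close>.
\<close>

record ('q, 'a) scheme =
  requests :: "'q set"
  nvar :: "'q \<Rightarrow> real"
  cost :: "'q \<Rightarrow> real"
  law :: "'q \<Rightarrow> 'a measure"
  wdens :: "nat \<Rightarrow> ('q, 'a) data \<Rightarrow> 'q \<Rightarrow> 'a \<Rightarrow> real"
  weight :: "'q \<Rightarrow> real"

text \<open>
  \<open>\<Omega>\<close>: candidates, \<open>n\<close>: number of input costs, \<open>c\<close>: input costs, \<open>S\<close>: laws of the evaluated points,
  \<open>gh\<close>: working densities, \<open>\<sigma>\<close>: noise standard deviation; in addition \<open>m\<close> and \<open>co\<close> for the number
  and the values of the output costs.
\<close>

definition scheme1 ::
    "'a set \<Rightarrow> nat \<Rightarrow> (nat \<Rightarrow> real) \<Rightarrow> ('a \<Rightarrow> nat \<Rightarrow> 'a measure)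
      \<Rightarrow> (nat \<Rightarrow> ('a \<times> nat, 'a) data \<Rightarrow> 'a \<Rightarrow> nat \<Rightarrow> 'a \<Rightarrow> real)
      \<Rightarrow> real \<Rightarrow> (nat \<Rightarrow> real) \<Rightarrow> ('a \<times> nat, 'a) scheme" where
  "scheme1 \<Omega> n c S gh \<sigma> \<kappa> =
     \<lparr>requests = \<Omega> \<times> {1..n},
      nvar = (\<lambda>_. \<sigma>\<^sup>2),
      cost = (\<lambda>(x, i). c i),
      law = (\<lambda>(x, i). S x i),
      wdens = (\<lambda>t d (x, i). gh t d x i),
      weight = (\<lambda>(x, i). \<kappa> i)\<rparr>"

definition scheme2 ::
    "'a set \<Rightarrow> nat \<Rightarrow> (nat \<Rightarrow> real) \<Rightarrow> ('a \<Rightarrow> nat \<Rightarrow> 'a measure)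
      \<Rightarrow> (nat \<Rightarrow> ('a \<times> nat \<times> nat, 'a) data \<Rightarrow> 'a \<Rightarrow> nat \<Rightarrow> 'a \<Rightarrow> real)
      \<Rightarrow> nat \<Rightarrow> (nat \<Rightarrow> real) \<Rightarrow> (nat \<Rightarrow> real) \<Rightarrow> (nat \<Rightarrow> nat \<Rightarrow> real)
      \<Rightarrow> ('a \<times> nat \<times> nat, 'a) scheme" where
  "scheme2 \<Omega> n c S gh m co \<sigma> \<kappa> =
     \<lparr>requests = \<Omega> \<times> {1..n} \<times> {1..m},
      nvar = (\<lambda>(x, i, j). (\<sigma> j)\<^sup>2),
      cost = (\<lambda>(x, i, j). c i + co j),
      law = (\<lambda>(x, i, j). S x i),
      wdens = (\<lambda>t d (x, i, j). gh t d x i),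
      weight = (\<lambda>(x, i, j). \<kappa> i j)\<rparr>"

definition acquisition ::
    "'a::euclidean_space level_set_problem \<Rightarrow> ('q, 'a) scheme \<Rightarrow> nat \<Rightarrow> ('q, 'a) data \<Rightarrow> 'q \<Rightarrow> real"
  where
  "acquisition P A t d q =
     (let v = nvar A;
          pred = (\<lambda>s. density lborel (normal_density (post_mean (ker P) v d s)
                        (sqrt (post_var (ker P) v d s + v q))));
          newHL = (\<lambda>s y. high_set P v (d @ [(q, s, y)]) \<union> low_set P v (d @ [(q, s, y)]))
      in inverse (cost A q) *
           ((LINT s|lborel. (LINT y|pred s. real (card (newHL s y))) * wdens A t d q s)
            - real (card (classified P v t d))))"

text \<open>
  The random quantities of a run, on a probability space with elements \<open>w\<close>.  Trials are numbered from
  1, and \<open>past t\<close> is the information available after \<open>t\<close> trials; \<open>coin t\<close> is the event \<open>r\<^sub>t = 1\<close>, and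
  \<open>draw t\<close> is \<open>C\<^sub>t\<close>.  No distribution is imposed on the black-box function and on the initial data:
  a fixed function and a sample path of the Gaussian process prior are both allowed, the prior
  itself enters through the posterior formulas above.
\<close>

record ('w, 'q, 'a) run =
  past :: "nat \<Rightarrow> 'w measure"
  blackbox :: "'w \<Rightarrow> 'a \<Rightarrow> real"
  init_size :: nat
  init_obs :: "nat \<Rightarrow> 'w \<Rightarrow> 'q \<times> 'a \<times> real"
  coin :: "nat \<Rightarrow> 'w \<Rightarrow> bool"
  draw :: "nat \<Rightarrow> 'w \<Rightarrow> 'q"
  request :: "nat \<Rightarrow> 'w \<Rightarrow> 'q"
  point :: "nat \<Rightarrow> 'w \<Rightarrow> 'a"
  noise :: "nat \<Rightarrow> 'w \<Rightarrow> real"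
  response :: "nat \<Rightarrow> 'w \<Rightarrow> real"

definition run_data :: "('w, 'q, 'a) run \<Rightarrow> nat \<Rightarrow> 'w \<Rightarrow> ('q, 'a) data" where
  "run_data R t w =
     map (\<lambda>j. init_obs R j w) [0..<init_size R] @
     map (\<lambda>u. (request R u w, point R u w, response R u w)) [1..<Suc t]"

definition run_unclassified ::
    "'a level_set_problem \<Rightarrow> ('q, 'a) scheme \<Rightarrow> ('w, 'q, 'a) run \<Rightarrow> nat \<Rightarrow> 'w \<Rightarrow> 'a set" where
  "run_unclassified P A R t w = unclassified P (nvar A) t (run_data R t w)"

definition completes_after ::
    "'a level_set_problem \<Rightarrow> ('q, 'a) scheme \<Rightarrow> ('w, 'q, 'a) run \<Rightarrow> nat \<Rightarrow> 'w \<Rightarrow> bool" where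
  "completes_after P A R t w \<longleftrightarrow>
     run_unclassified P A R t w = {} \<and> (\<forall>u<t. run_unclassified P A R u w \<noteq> {})"

text \<open>
  With \<open>stop = True\<close> the termination condition is applied, with \<open>stop = False\<close> it is ignored.
  The values of a run are unconstrained (up to measurability) in trials that are not performed; they
  do not influence \<^const>\<open>completes_after\<close>.
\<close>

definition performed ::
    "bool \<Rightarrow> 'a level_set_problem \<Rightarrow> ('q, 'a) scheme \<Rightarrow> ('w, 'q, 'a) run \<Rightarrow> nat \<Rightarrow> 'w \<Rightarrow> bool" where
  "performed stop P A R t w \<longleftrightarrow> (stop \<longrightarrow> (\<forall>u<t. run_unclassified P A R u w \<noteq> {}))"

text \<open>
  The laws of the random quantities of a trial are stated as product formulas for events \<open>E\<close> of the
  past.  As the set of requests is finite, \<open>point_law\<close> says that given the past, the coin, the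
  draw and the request, the evaluated point has the true law belonging to the request.
\<close>

locale algorithm_run = prob_space M + filtration "space M" "past R"
  for stop :: bool
    and P :: "'a::euclidean_space level_set_problem"
    and A :: "('q, 'a) scheme"
    and p :: "nat \<Rightarrow> real"
    and M :: "'w measure"
    and R :: "('w, 'q, 'a) run" +
  assumes past_subalgebra: "\<And>t. subalgebra M (past R t)"
    and blackbox_measurable:
      "\<And>x. x \<in> inputs P \<Longrightarrow> (\<lambda>w. blackbox R w x) \<in> borel_measurable (past R 0)"
    and init_measurable:
      "\<And>j. j < init_size R \<Longrightarrow>
        init_obs R j \<in> past R 0 \<rightarrow>\<^sub>M
          count_space (requests A) \<Otimes>\<^sub>M restrict_space borel (inputs P) \<Otimes>\<^sub>M borel"
    and coin_measurable: "\<And>t. 1 \<le> t \<Longrightarrow> coin R t \<in> past R t \<rightarrow>\<^sub>M count_space UNIV"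
    and draw_measurable: "\<And>t. 1 \<le> t \<Longrightarrow> draw R t \<in> past R t \<rightarrow>\<^sub>M count_space (requests A)"
    and request_measurable: "\<And>t. 1 \<le> t \<Longrightarrow> request R t \<in> past R t \<rightarrow>\<^sub>M count_space (requests A)"
    and point_measurable: "\<And>t. 1 \<le> t \<Longrightarrow> point R t \<in> past R t \<rightarrow>\<^sub>M restrict_space borel (inputs P)"
    and noise_measurable: "\<And>t. 1 \<le> t \<Longrightarrow> noise R t \<in> borel_measurable (past R t)"
    and response_measurable: "\<And>t. 1 \<le> t \<Longrightarrow> response R t \<in> borel_measurable (past R t)"
    and performed_measurable:
      "\<And>t. {w \<in> space M. performed stop P A R (Suc t) w} \<in> sets (past R t)"
    and working_density:
      "\<And>t w q. w \<in> space M \<Longrightarrow> performed stop P A R (Suc t) w \<Longrightarrow> q \<in> requests A \<Longrightarrow>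
        prob_density_on (inputs P) (wdens A t (run_data R t w) q)"
    and coin_draw_law:
      "\<And>t E b q. E \<in> sets (past R t) \<Longrightarrow> (\<And>w. w \<in> E \<Longrightarrow> performed stop P A R (Suc t) w) \<Longrightarrow>
        q \<in> requests A \<Longrightarrow>
        prob {w \<in> E. coin R (Suc t) w = b \<and> draw R (Suc t) w = q} =
          prob E * pmf (bernoulli_pmf (p (Suc t))) b * weight A q"
    and request_random:
      "\<And>t w. w \<in> space M \<Longrightarrow> performed stop P A R (Suc t) w \<Longrightarrow> coin R (Suc t) w \<Longrightarrow>
        request R (Suc t) w = draw R (Suc t) w"
    and request_maximal:
      "\<And>t w. w \<in> space M \<Longrightarrow> performed stop P A R (Suc t) w \<Longrightarrow> \<not> coin R (Suc t) w \<Longrightarrow>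
        is_arg_max (acquisition P A t (run_data R t w)) (\<lambda>q. q \<in> requests A) (request R (Suc t) w)"
    and point_law:
      "\<And>t E b q q' B. E \<in> sets (past R t) \<Longrightarrow> (\<And>w. w \<in> E \<Longrightarrow> performed stop P A R (Suc t) w) \<Longrightarrow>
        q \<in> requests A \<Longrightarrow> q' \<in> requests A \<Longrightarrow> B \<in> sets (restrict_space borel (inputs P)) \<Longrightarrow>
        prob {w \<in> E. coin R (Suc t) w = b \<and> draw R (Suc t) w = q \<and> request R (Suc t) w = q' \<and>
            point R (Suc t) w \<in> B} =
          prob {w \<in> E. coin R (Suc t) w = b \<and> draw R (Suc t) w = q \<and> request R (Suc t) w = q'} *
          measure (law A q') B"
    and noise_law:
      "\<And>t E b q q' B Y. E \<in> sets (past R t) \<Longrightarrow> (\<And>w. w \<in> E \<Longrightarrow> performed stop P A R (Suc t) w) \<Longrightarrow>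
        q \<in> requests A \<Longrightarrow> q' \<in> requests A \<Longrightarrow> B \<in> sets (restrict_space borel (inputs P)) \<Longrightarrow>
        Y \<in> sets borel \<Longrightarrow>
        prob {w \<in> E. coin R (Suc t) w = b \<and> draw R (Suc t) w = q \<and> request R (Suc t) w = q' \<and>
            point R (Suc t) w \<in> B \<and> noise R (Suc t) w \<in> Y} =
          prob {w \<in> E. coin R (Suc t) w = b \<and> draw R (Suc t) w = q \<and> request R (Suc t) w = q' \<and>
            point R (Suc t) w \<in> B} *
          measure (density lborel (normal_density 0 (sqrt (nvar A q')))) Y"
    and response_eq:
      "\<And>t w. w \<in> space M \<Longrightarrow> performed stop P A R (Suc t) w \<Longrightarrow>
        response R (Suc t) w = blackbox R w (point R (Suc t) w) + noise R (Suc t) w"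


section \<open>Conditions and constants of the bounds\<close>

definition nbhd :: "'a::euclidean_space set \<Rightarrow> 'a \<Rightarrow> real \<Rightarrow> 'a set" where
  "nbhd D x \<eta> = {a \<in> D. norm (a - x) < \<eta>}"

definition cond_A1 :: "(nat \<Rightarrow> real) \<Rightarrow> bool" where
  "cond_A1 p \<longleftrightarrow> filterlim (\<lambda>n. \<Sum>t=1..n. p t) at_top sequentially"

definition cond_A1' :: "(nat \<Rightarrow> real) \<Rightarrow> real \<Rightarrow> bool" where
  "cond_A1' p ps \<longleftrightarrow> 0 < ps \<and> ps < 1 \<and> (\<forall>t\<ge>1. ps \<le> p t)"

definition cond_A2 ::
    "'a::euclidean_space set \<Rightarrow> 'a set \<Rightarrow> nat \<Rightarrow> ('a \<Rightarrow> nat \<Rightarrow> 'a measure) \<Rightarrow> bool" where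
  "cond_A2 D \<Omega> n S \<longleftrightarrow>
     (\<forall>x\<in>\<Omega>. \<forall>\<eta>>0. \<exists>x'\<in>\<Omega>. \<exists>i\<in>{1..n}. measure (S x' i) (nbhd D x \<eta>) > 0)"

definition cond_A3 ::
    "'a::euclidean_space set \<Rightarrow> 'a set \<Rightarrow> ('a \<Rightarrow> 'a \<Rightarrow> real) \<Rightarrow> bool" where
  "cond_A3 D \<Omega> k \<longleftrightarrow> (\<forall>x\<in>\<Omega>. continuous (at (x, x) within D \<times> D) (\<lambda>(a, b). k a b))"

definition visits_needed :: "real \<Rightarrow> real \<Rightarrow> real \<Rightarrow> nat" where
  "visits_needed \<beta> v \<epsilon> = (LEAST n::nat. 0 < n \<and> real n > 2 * \<beta> * v / \<epsilon>\<^sup>2)"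

definition good_radius ::
    "'a::euclidean_space set \<Rightarrow> 'a set \<Rightarrow> ('a \<Rightarrow> 'a \<Rightarrow> real) \<Rightarrow> real \<Rightarrow> real \<Rightarrow> real \<Rightarrow> nat \<Rightarrow> real \<Rightarrow> bool"
  where
  "good_radius D \<Omega> k \<beta> \<epsilon> v T \<nu> \<longleftrightarrow> 0 < \<nu> \<and>
     (\<forall>x\<in>\<Omega>. \<forall>as. length as = T \<and> set as \<subseteq> nbhd D x \<nu> \<longrightarrow>
        \<bar>repeat_var k v T x - tuple_var k v as x\<bar> < \<epsilon>\<^sup>2 / (2 * \<beta>))"

definition min_hit_prob ::
    "'a::euclidean_space set \<Rightarrow> 'a set \<Rightarrow> nat \<Rightarrow> ('a \<Rightarrow> nat \<Rightarrow> 'a measure) \<Rightarrow> (nat \<Rightarrow> real) \<Rightarrow> real \<Rightarrow> real"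
  where
  "min_hit_prob D \<Omega> n S \<kappa> \<nu> =
     Min ((\<lambda>x. \<Sum>a\<in>\<Omega>. \<Sum>i=1..n. \<kappa> i * measure (S a i) (nbhd D x \<nu>)) ` \<Omega>)"

definition trial_blocks :: "(nat \<Rightarrow> real) \<Rightarrow> real \<Rightarrow> real \<Rightarrow> nat \<Rightarrow> (nat \<Rightarrow> nat) \<Rightarrow> bool" where
  "trial_blocks p q \<delta> m N \<longleftrightarrow> N 0 = 0 \<and>
     (\<forall>j\<in>{1..m}. N (j - 1) < N j \<and> (\<Prod>t=N (j - 1) + 1..N j. 1 - p t * q) < \<delta> / real m)"

definition block_length :: "real \<Rightarrow> real \<Rightarrow> nat \<Rightarrow> nat" where
  "block_length p \<delta> m = (LEAST r::nat. 0 < r \<and> real r > ln (real m / \<delta>) / (- ln (1 - p)))"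

end

theory Submission
  imports Defs "Jordan_Normal_Form.Determinant"
begin

text \<open>
  The posterior variance is the minimum over all coefficient vectors of the mean squared error of a
  linear predictor.  Hence discarding data cannot decrease it, and averaging \<open>T\<close> observations made near
  a candidate bounds it by \<open>v / T\<close> up to the oscillation of the kernel.  Once it is below
  \<open>\<epsilon>\<^sup>2 / \<beta>\<close>, the interval \<open>\<mu> \<plusminus> sqrt \<beta> * \<sigma>\<close> has length less than \<open>2 * \<epsilon>\<close> and the
  candidate is classified.  Whatever the acquisition function does, trial \<open>t\<close> evaluates a point near
  a given candidate with conditional probability at least \<open>p\<^sub>t * q\<close>, because this already happens
  when the request is drawn at random.  So a block of trials misses the candidate with probability at
  most \<open>\<Prod>(1 - p\<^sub>t * q)\<close>, and a union bound over \<open>T\<close> blocks for each candidate finishes the proof.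
\<close>

section \<open>Posterior variance\<close>

lemma mat_inverse_solve:
  fixes C :: "real mat" and b :: "real vec"
  assumes C: "C \<in> carrier_mat n n" and b: "b \<in> carrier_vec n"
    and pos: "\<And>a. \<exists>i<n. a i \<noteq> 0 \<Longrightarrow> (\<Sum>i<n. \<Sum>j<n. a i * a j * C $$ (i, j)) > 0"
  shows "\<exists>g. (\<forall>i<n. (\<Sum>j<n. C $$ (i, j) * g j) = b $ i) \<and>
             b \<bullet> (the (mat_inverse C) *\<^sub>v b) = (\<Sum>i<n. b $ i * g i)"
proof -
  \<comment> \<open>A vector in the null space of \<open>C\<close> would make the quadratic form
    vanish, so positivity forces an invertible matrix. Then \<open>mat_inverse\<close> returns
    \<open>Some\<close>, and \<open>the\<close> in the conclusion denotes a genuine inverse.\<close>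
  have "det C \<noteq> 0"
  proof
    assume "det C = 0"
    then obtain v where v: "v \<in> carrier_vec n" "v \<noteq> 0\<^sub>v n" "C *\<^sub>v v = 0\<^sub>v n"
      using det_0_iff_vec_prod_zero[OF C] by auto
    then have "\<exists>i<n. v $ i \<noteq> 0"
      by (metis carrier_vecD dim_vec eq_vecI index_zero_vec)
    then have "(\<Sum>i<n. \<Sum>j<n. v $ i * v $ j * C $$ (i, j)) > 0" by (rule pos)
    moreover have "(\<Sum>j<n. v $ i * v $ j * C $$ (i, j)) = 0" if "i < n" for i
    proof -
      have "(C *\<^sub>v v) $ i = 0" using v(3) that by simp
      then have "(\<Sum>j<n. C $$ (i, j) * v $ j) = 0"
        using C v(1) that by (simp add: scalar_prod_def lessThan_atLeast0)
      moreover have "(\<Sum>j<n. v $ i * v $ j * C $$ (i, j)) = v $ i * (\<Sum>j<n. C $$ (i, j) * v $ j)"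
        by (simp add: sum_distrib_left mult_ac)
      ultimately show ?thesis by simp
    qed
    ultimately show False by simp
  qed
  then have "C \<in> Units (ring_mat TYPE(real) n ())"
    by (rule det_non_zero_imp_unit[OF C])
  then obtain G where G: "mat_inverse C = Some G"
    using mat_inverse(1)[OF C, of "()"] by fastforce
  then have inv: "C * G = 1\<^sub>m n" "G \<in> carrier_mat n n"
    using mat_inverse(2)[OF C] by auto
  define g where "g = G *\<^sub>v b"
  have g: "g \<in> carrier_vec n" using inv(2) b by (simp add: g_def)
  have Cg: "C *\<^sub>v g = b"
    unfolding g_def using assoc_mult_mat_vec[OF C inv(2) b] inv(1) b by simp
  show ?thesis
  proof (rule exI[of _ "\<lambda>i. g $ i"], intro conjI allI impI)
    fix i assume "i < n"
    then show "(\<Sum>j<n. C $$ (i, j) * g $ j) = b $ i"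
      using arg_cong[OF Cg, of "\<lambda>v. v $ i"] C g by (simp add: scalar_prod_def lessThan_atLeast0)
  next
    show "b \<bullet> (the (mat_inverse C) *\<^sub>v b) = (\<Sum>i<n. b $ i * g $ i)"
      using G g by (simp add: g_def[symmetric] scalar_prod_def lessThan_atLeast0)
  qed
qed

section \<open>Positive definite kernels and best linear prediction\<close>

lemma pos_def_kernel_sym: "pos_def_kernel D k \<Longrightarrow> x \<in> D \<Longrightarrow> y \<in> D \<Longrightarrow> k x y = k y x"
  unfolding pos_def_kernel_def by blast

text \<open>Positive definiteness is defined with sums over sets of points, whereas a run may
  evaluate the same point several times. Collecting the coefficients of equal points in
  \<open>A\<close> reduces the indexed form to the set form.\<close>

lemma pos_def_kernel_sum_nonneg:
  assumes k: "pos_def_kernel D k" and I: "finite I" and s: "\<And>i. i \<in> I \<Longrightarrow> s i \<in> D"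
  shows "0 \<le> (\<Sum>i\<in>I. \<Sum>j\<in>I. a i * a j * k (s i) (s j))"
proof -
  define A where "A x = (\<Sum>i\<in>{i\<in>I. s i = x}. a i)" for x
  have inner: "(\<Sum>y\<in>s ` I. A y * f y) = (\<Sum>j\<in>I. a j * f (s j))" for f :: "_ \<Rightarrow> real"
  proof -
    have "(\<Sum>y\<in>s ` I. A y * f y) = (\<Sum>y\<in>s ` I. \<Sum>j\<in>{j\<in>I. s j = y}. a j * f (s j))"
      by (simp add: A_def sum_distrib_right)
    also have "\<dots> = (\<Sum>j\<in>I. a j * f (s j))"
      by (rule sum.image_gen[OF I, symmetric])
    finally show ?thesis .
  qed
  have "(\<Sum>x\<in>s ` I. \<Sum>y\<in>s ` I. A x * A y * k x y)
      = (\<Sum>x\<in>s ` I. A x * (\<Sum>y\<in>s ` I. A y * k x y))"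
    by (simp add: sum_distrib_left mult_ac)
  also have "\<dots> = (\<Sum>i\<in>I. a i * (\<Sum>j\<in>I. a j * k (s i) (s j)))"
    by (simp add: inner)
  also have "\<dots> = (\<Sum>i\<in>I. \<Sum>j\<in>I. a i * a j * k (s i) (s j))"
    by (simp add: sum_distrib_left mult_ac)
  finally have eq: "(\<Sum>x\<in>s ` I. \<Sum>y\<in>s ` I. A x * A y * k x y)
      = (\<Sum>i\<in>I. \<Sum>j\<in>I. a i * a j * k (s i) (s j))" .
  have "0 \<le> (\<Sum>x\<in>s ` I. \<Sum>y\<in>s ` I. A x * A y * k x y)"
    using k I s unfolding pos_def_kernel_def by blast
  then show ?thesis unfolding eq .
qed

text \<open>The mean squared error of the linear predictor of \<open>f x\<close> with coefficients \<open>a\<close>.\<close>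

definition linear_error ::
    "('a \<Rightarrow> 'a \<Rightarrow> real) \<Rightarrow> 'a list \<Rightarrow> real list \<Rightarrow> 'a \<Rightarrow> (nat \<Rightarrow> real) \<Rightarrow> real" where
  "linear_error k ss vs x a =
     k x x - 2 * (\<Sum>i<length ss. a i * k (ss ! i) x)
     + (\<Sum>i<length ss. a i * (\<Sum>j<length ss. a j * k (ss ! i) (ss ! j)))
     + (\<Sum>i<length ss. a i * (a i * vs ! i))"

text \<open>The noise variances form a list, one per observation, because output costs make them
  vary from trial to trial. The constant noise of \<open>tuple_var\<close> is the special case of a
  replicated list.\<close>

locale gp_regression =
  fixes D :: "'a set" and k :: "'a \<Rightarrow> 'a \<Rightarrow> real" and ss :: "'a list" and vs :: "real list"
  assumes kernel: "pos_def_kernel D k" and points: "set ss \<subseteq> D"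
    and len: "length vs = length ss" and noise_pos: "\<And>v. v \<in> set vs \<Longrightarrow> 0 < v"
begin

abbreviation n where "n \<equiv> length ss"

definition C where "C i j = k (ss ! i) (ss ! j) + (if i = j then vs ! i else 0)"

lemma C_quadratic:
  "(\<Sum>i<n. \<Sum>j<n. a i * a j * C i j)
    = (\<Sum>i<n. a i * (\<Sum>j<n. a j * k (ss ! i) (ss ! j))) + (\<Sum>i<n. a i * (a i * vs ! i))"
proof -
  have "(\<Sum>j<n. a i * a j * C i j)
      = a i * (\<Sum>j<n. a j * k (ss ! i) (ss ! j)) + a i * (a i * vs ! i)" if "i < n" for i
  proof -
    have "(\<Sum>j<n. a i * a j * C i j)
        = (\<Sum>j<n. a i * (a j * k (ss ! i) (ss ! j)) + (if j = i then a i * (a i * vs ! i) else 0))"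
      by (intro sum.cong refl) (simp add: C_def algebra_simps)
    then show ?thesis using that by (simp add: sum.distrib sum_distrib_left)
  qed
  then show ?thesis by (simp add: sum.distrib)
qed

lemma kernel_part_nonneg: "0 \<le> (\<Sum>i<n. a i * (\<Sum>j<n. a j * k (ss ! i) (ss ! j)))"
proof -
  have "0 \<le> (\<Sum>i<n. \<Sum>j<n. a i * a j * k (ss ! i) (ss ! j))"
    using points by (intro pos_def_kernel_sum_nonneg[OF kernel]) auto
  then show ?thesis by (simp add: sum_distrib_left mult_ac)
qed

lemma vs_pos: "i < n \<Longrightarrow> 0 < vs ! i"
  using noise_pos len by simp

lemma noise_term_nonneg: "i < n \<Longrightarrow> 0 \<le> b * (b * vs ! i)"
  using vs_pos[of i] by (auto simp: zero_le_mult_iff mult_le_0_iff)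

lemma noise_part_nonneg: "0 \<le> (\<Sum>i<n. a i * (a i * vs ! i))"
  by (intro sum_nonneg) (simp add: noise_term_nonneg)

lemma C_nonneg: "0 \<le> (\<Sum>i<n. \<Sum>j<n. a i * a j * C i j)"
  unfolding C_quadratic by (rule add_nonneg_nonneg[OF kernel_part_nonneg noise_part_nonneg])

lemma C_pos:
  assumes "\<exists>i<n. a i \<noteq> 0"
  shows "0 < (\<Sum>i<n. \<Sum>j<n. a i * a j * C i j)"
proof -
  obtain i where i: "i < n" "a i \<noteq> 0" using assms by blast
  have "0 < (\<Sum>i<n. a i * (a i * vs ! i))"
  proof (rule sum_pos2[of _ i])
    show "0 < a i * (a i * vs ! i)"
      using i vs_pos[of i] by (auto simp: zero_less_mult_iff mult_less_0_iff)
  qed (use i in \<open>simp_all add: noise_term_nonneg\<close>)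
  then show ?thesis unfolding C_quadratic using kernel_part_nonneg[of a] by simp
qed

lemma C_sym: "i < n \<Longrightarrow> j < n \<Longrightarrow> C i j = C j i"
  using points by (simp add: C_def pos_def_kernel_sym[OF kernel] subset_iff)

text \<open>Trades the inverse matrix for a solution \<open>g\<close> of the normal equations, so
  that the arguments about minimal error use finite sums only.\<close>

lemma gp_cov_solve:
  "\<exists>g. (\<forall>i<n. (\<Sum>j<n. C i j * g j) = k (ss ! i) x) \<and>
    gp_cov k ss vs x x = k x x - (\<Sum>i<n. k (ss ! i) x * g i)"
proof -
  define M where "M = kernel_mat k ss + mat_diag n (\<lambda>i. vs ! i)"
  have M: "M \<in> carrier_mat n n" by (simp add: M_def kernel_mat_def)
  have entry: "M $$ (i, j) = C i j" if "i < n" "j < n" for i j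
    using that by (simp add: M_def kernel_mat_def mat_diag_def C_def)
  have b: "kernel_vec k ss x \<in> carrier_vec n" by (simp add: kernel_vec_def)
  have "\<exists>g. (\<forall>i<n. (\<Sum>j<n. M $$ (i, j) * g j) = kernel_vec k ss x $ i) \<and>
      kernel_vec k ss x \<bullet> (the (mat_inverse M) *\<^sub>v kernel_vec k ss x)
        = (\<Sum>i<n. kernel_vec k ss x $ i * g i)"
  proof (rule mat_inverse_solve[OF M b])
    fix a :: "nat \<Rightarrow> real" assume "\<exists>i<n. a i \<noteq> 0"
    then show "0 < (\<Sum>i<n. \<Sum>j<n. a i * a j * M $$ (i, j))"
      using C_pos[of a] by (simp add: entry)
  qed
  then show ?thesis
    by (simp add: entry kernel_vec_def gp_cov_def gp_gain_def M_def[symmetric])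
qed

text \<open>Completing the square: the error at \<open>a\<close> exceeds the error at the solution
  \<open>g\<close> of the normal equations by the quadratic form of \<open>C\<close> at
  \<open>a - g\<close>, which is nonnegative. So the posterior variance is an attained
  minimum.\<close>

lemma linear_error_gp_cov:
  obtains g where "gp_cov k ss vs x x = linear_error k ss vs x g"
    and "\<And>a. gp_cov k ss vs x x \<le> linear_error k ss vs x a"
proof -
  obtain g where g: "\<And>i. i < n \<Longrightarrow> (\<Sum>j<n. C i j * g j) = k (ss ! i) x"
    and cov: "gp_cov k ss vs x x = k x x - (\<Sum>i<n. k (ss ! i) x * g i)"
    using gp_cov_solve[of x] by auto
  \<comment> \<open>The normal equations turn the mixed terms of the square into the linear term of
    the error; the symmetry of \<open>C\<close> gives the same value for the other order of
    factors.\<close>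
  have cross: "(\<Sum>i<n. \<Sum>j<n. a i * g j * C i j) = (\<Sum>i<n. a i * k (ss ! i) x)" for a
  proof -
    have "(\<Sum>i<n. \<Sum>j<n. a i * g j * C i j) = (\<Sum>i<n. a i * (\<Sum>j<n. C i j * g j))"
      by (simp add: sum_distrib_left mult_ac)
    then show ?thesis by (simp add: g)
  qed
  have cross': "(\<Sum>i<n. \<Sum>j<n. g i * a j * C i j) = (\<Sum>i<n. a i * k (ss ! i) x)" for a
  proof -
    have "(\<Sum>i<n. \<Sum>j<n. g i * a j * C i j) = (\<Sum>j<n. \<Sum>i<n. g i * a j * C i j)"
      by (rule sum.swap)
    also have "\<dots> = (\<Sum>j<n. \<Sum>i<n. a j * g i * C j i)"
      by (intro sum.cong refl) (simp add: C_sym)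
    finally show ?thesis by (simp add: cross)
  qed
  have err: "linear_error k ss vs x a
      = k x x - 2 * (\<Sum>i<n. a i * k (ss ! i) x) + (\<Sum>i<n. \<Sum>j<n. a i * a j * C i j)" for a
    unfolding C_quadratic linear_error_def by simp
  have "gp_cov k ss vs x x = linear_error k ss vs x g"
    unfolding err cross cov by (simp add: mult.commute)
  moreover have "gp_cov k ss vs x x \<le> linear_error k ss vs x a" for a
  proof -
    have "(\<Sum>i<n. \<Sum>j<n. (a i - g i) * (a j - g j) * C i j)
      = (\<Sum>i<n. \<Sum>j<n. a i * a j * C i j) - (\<Sum>i<n. \<Sum>j<n. a i * g j * C i j)
        - (\<Sum>i<n. \<Sum>j<n. g i * a j * C i j) + (\<Sum>i<n. \<Sum>j<n. g i * g j * C i j)"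
      by (simp add: algebra_simps sum.distrib sum_subtractf)
    then have "(\<Sum>i<n. \<Sum>j<n. (a i - g i) * (a j - g j) * C i j)
      = (\<Sum>i<n. \<Sum>j<n. a i * a j * C i j) - 2 * (\<Sum>i<n. a i * k (ss ! i) x)
        + (\<Sum>i<n. k (ss ! i) x * g i)"
      unfolding cross cross' by (simp add: mult.commute)
    then show ?thesis
      unfolding err cov using C_nonneg[of "\<lambda>i. a i - g i"] by linarith
  qed
  ultimately show thesis by (rule that)
qed

lemma gp_cov_le_linear_error: "gp_cov k ss vs x x \<le> linear_error k ss vs x a"
  by (metis linear_error_gp_cov)

lemma gp_cov_nonneg:
  assumes x: "x \<in> D"
  shows "0 \<le> gp_cov k ss vs x x"
proof -
  obtain g where g: "gp_cov k ss vs x x = linear_error k ss vs x g"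
    by (metis linear_error_gp_cov)
  \<comment> \<open>The kernel part of the error is the quadratic form of the points
    \<open>ss\<close> extended by \<open>x\<close>, with coefficients \<open>- g i\<close> at the
    data and 1 at \<open>x\<close>; this is the variance of \<open>f x\<close> minus its
    prediction.\<close>
  let ?a = "\<lambda>i. if i < n then - g i else 1" and ?s = "\<lambda>i. if i < n then ss ! i else x"
  have "0 \<le> (\<Sum>i<Suc n. \<Sum>j<Suc n. ?a i * ?a j * k (?s i) (?s j))"
    using x points by (intro pos_def_kernel_sum_nonneg[OF kernel]) auto
  also have "\<dots> = (\<Sum>i<n. \<Sum>j<n. g i * g j * k (ss ! i) (ss ! j))
      - (\<Sum>i<n. g i * k (ss ! i) x) - (\<Sum>j<n. g j * k x (ss ! j)) + k x x"
    by (simp add: sum.distrib sum_subtractf sum_negf)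
  also have "(\<Sum>j<n. g j * k x (ss ! j)) = (\<Sum>j<n. g j * k (ss ! j) x)"
    using points x by (intro sum.cong refl) (simp add: pos_def_kernel_sym[OF kernel] subset_iff)
  finally have "0 \<le> (\<Sum>i<n. \<Sum>j<n. g i * g j * k (ss ! i) (ss ! j))
      - (\<Sum>i<n. g i * k (ss ! i) x) - (\<Sum>j<n. g j * k (ss ! j) x) + k x x" .
  moreover have "(\<Sum>i<n. \<Sum>j<n. g i * g j * k (ss ! i) (ss ! j))
      = (\<Sum>i<n. g i * (\<Sum>j<n. g j * k (ss ! i) (ss ! j)))"
    by (simp add: sum_distrib_left mult.assoc)
  ultimately show ?thesis unfolding g linear_error_def using noise_part_nonneg[of g] by linarith
qed

text \<open>A predictor built from selected observations is also a predictor for all data, and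
  raising their noise to \<open>v\<close> only increases its error. Injectivity of \<open>f\<close>
  keeps the selected observations distinct, so that their noise terms count as independent.\<close>

lemma gp_cov_le_tuple_var:
  assumes f: "inj_on f {..<T}" and fn: "\<And>i. i < T \<Longrightarrow> f i < n"
    and v: "\<And>i. i < T \<Longrightarrow> vs ! f i \<le> v"
  shows "gp_cov k ss vs x x \<le> tuple_var k v (map (\<lambda>i. ss ! f i) [0..<T]) x"
proof (cases "T = 0")
  \<comment> \<open>With nothing selected, no observation certifies that \<open>v\<close> is
    positive; the zero predictor settles this case directly.\<close>
  case True
  show ?thesis
    using gp_cov_le_linear_error[of x "\<lambda>_. 0"] True
    by (simp add: linear_error_def tuple_var_def gp_cov_def kernel_vec_def scalar_prod_def)
next
  case False
  let ?as = "map (\<lambda>i. ss ! f i) [0..<T]"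
  have "0 < v" using v[of 0] fn[of 0] vs_pos[of "f 0"] False by simp
  interpret sub: gp_regression D k ?as "replicate T v"
    using kernel points fn \<open>0 < v\<close> by unfold_locales auto
  obtain g where g: "gp_cov k ?as (replicate T v) x x = linear_error k ?as (replicate T v) x g"
    by (metis sub.linear_error_gp_cov)
  \<comment> \<open>The optimal coefficients of the selection, extended by zero to the discarded
    observations.\<close>
  define a where "a j = (if j \<in> f ` {..<T} then g (the_inv_into {..<T} f j) else 0)" for j
  have af: "a (f i) = g i" if "i < T" for i
    using that f by (auto simp: a_def the_inv_into_f_f)
  have a_sum: "(\<Sum>j<n. a j * F j) = (\<Sum>i<T. g i * F (f i))" for F
  proof -
    have "(\<Sum>j<n. a j * F j) = (\<Sum>j\<in>f ` {..<T}. a j * F j)"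
      using fn by (intro sum.mono_neutral_right) (auto simp: a_def)
    then show ?thesis by (simp add: sum.reindex[OF f] af)
  qed
  have "linear_error k ss vs x a \<le> linear_error k ?as (replicate T v) x g"
    unfolding linear_error_def a_sum
    by (auto simp: af v intro!: sum_mono mult_left_mono simp: mult.assoc[symmetric])
  then show ?thesis
    using gp_cov_le_linear_error[of x a] by (simp add: tuple_var_def g)
qed

end

section \<open>Variance after averaging observations near a candidate\<close>

lemma tuple_var_le:
  assumes k: "pos_def_kernel D k" and D: "set as \<subseteq> D" and v: "0 < v" and T: "0 < length as"
    and lower: "\<And>a. a \<in> set as \<Longrightarrow> k x x - e \<le> k a x"
    and upper: "\<And>a b. a \<in> set as \<Longrightarrow> b \<in> set as \<Longrightarrow> k a b \<le> k x x + e"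
  shows "tuple_var k v as x \<le> v / real (length as) + 3 * e"
proof -
  let ?T = "length as" and ?r = "1 / real (length as)"
  interpret gp_regression D k as "replicate ?T v"
    using k D v by unfold_locales auto
  \<comment> \<open>The plain average as predictor. Its cross term costs at most
    \<open>2 * e\<close> and its kernel part at most \<open>e\<close>, which makes
    \<open>3 * e\<close>; the averaged noise contributes \<open>v\<close> divided by the number of
    points.\<close>
  have "tuple_var k v as x \<le> linear_error k as (replicate ?T v) x (\<lambda>_. ?r)"
    unfolding tuple_var_def by (rule gp_cov_le_linear_error)
  also have "\<dots> = k x x - 2 * (\<Sum>i<?T. ?r * k (as ! i) x)
     + (\<Sum>i<?T. ?r * (\<Sum>j<?T. ?r * k (as ! i) (as ! j))) + (\<Sum>i<?T. ?r * (?r * v))"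
    by (simp add: linear_error_def)
  also have "\<dots> \<le> k x x - 2 * (\<Sum>i<?T. ?r * (k x x - e))
     + (\<Sum>i<?T. ?r * (\<Sum>j<?T. ?r * (k x x + e))) + (\<Sum>i<?T. ?r * (?r * v))"
    using lower upper
    by (intro add_mono diff_mono mult_left_mono sum_mono order_refl) auto
  also have "\<dots> = v / real ?T + 3 * e"
    using T by (simp add: field_simps)
  finally show ?thesis .
qed

text \<open>Makes the averaging bound available for repeated evaluation of \<open>x\<close> itself,
  where nothing oscillates and \<open>e = 0\<close> is admissible.\<close>

lemma repeat_var_eq_tuple_var: "repeat_var k v t x = tuple_var k v (replicate t x) x"
proof -
  have "kernel_mat k (replicate t x) + mat_diag t (\<lambda>i. replicate t v ! i)
      = mat t t (\<lambda>_. k x x) + v \<cdot>\<^sub>m 1\<^sub>m t"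
    by (auto simp: kernel_mat_def mat_diag_def)
  moreover have "kernel_vec k (replicate t x) x = vec t (\<lambda>_. k x x)"
    by (auto simp: kernel_vec_def)
  ultimately show ?thesis
    by (simp add: repeat_var_def tuple_var_def gp_cov_def gp_gain_def Let_def)
qed

lemma repeat_var_le:
  assumes "pos_def_kernel D k" "x \<in> D" "0 < v" "0 < t"
  shows "repeat_var k v t x \<le> v / real t"
  using tuple_var_le[of D k "replicate t x" v x 0] assms
  by (simp add: repeat_var_eq_tuple_var set_replicate_conv_if)

lemma visits_needed:
  "0 < visits_needed \<beta> v \<epsilon>" "2 * \<beta> * v / \<epsilon>\<^sup>2 < real (visits_needed \<beta> v \<epsilon>)"
proof -
  obtain n where "2 * \<beta> * v / \<epsilon>\<^sup>2 < real n" using reals_Archimedean2 by blast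
  then have "0 < Suc n \<and> 2 * \<beta> * v / \<epsilon>\<^sup>2 < real (Suc n)" by simp
  then have "0 < visits_needed \<beta> v \<epsilon> \<and> 2 * \<beta> * v / \<epsilon>\<^sup>2 < real (visits_needed \<beta> v \<epsilon>)"
    unfolding visits_needed_def by (rule LeastI)
  then show "0 < visits_needed \<beta> v \<epsilon>" "2 * \<beta> * v / \<epsilon>\<^sup>2 < real (visits_needed \<beta> v \<epsilon>)"
    by auto
qed

text \<open>The budget \<open>\<epsilon>\<^sup>2 / \<beta>\<close> is split in two halves: the
  number of visits brings the averaged noise below one half, and the radius bounds the effect of
  displaced points by the other.\<close>

lemma good_radius_tuple_var:
  assumes k: "pos_def_kernel D k" and "\<Omega> \<subseteq> D" and pos: "0 < \<beta>" "0 < \<epsilon>" "0 < v"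
    and rad: "good_radius D \<Omega> k \<beta> \<epsilon> v (visits_needed \<beta> v \<epsilon>) \<nu>"
    and x: "x \<in> \<Omega>" and "as": "length as = visits_needed \<beta> v \<epsilon>" "set as \<subseteq> nbhd D x \<nu>"
  shows "tuple_var k v as x < \<epsilon>\<^sup>2 / \<beta>"
proof -
  let ?T = "visits_needed \<beta> v \<epsilon>"
  have "\<bar>repeat_var k v ?T x - tuple_var k v as x\<bar> < \<epsilon>\<^sup>2 / (2 * \<beta>)"
    using rad x "as" unfolding good_radius_def by blast
  moreover have "repeat_var k v ?T x \<le> v / real ?T"
    using repeat_var_le[OF k _ \<open>0 < v\<close> visits_needed(1)] x \<open>\<Omega> \<subseteq> D\<close> by blast
  moreover have "v / real ?T < \<epsilon>\<^sup>2 / (2 * \<beta>)"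
    using visits_needed[of \<beta> v \<epsilon>] pos by (simp add: field_simps)
  moreover have "\<epsilon>\<^sup>2 / (2 * \<beta>) + \<epsilon>\<^sup>2 / (2 * \<beta>) = \<epsilon>\<^sup>2 / \<beta>" using pos by (simp add: field_simps)
  ultimately show ?thesis by linarith
qed

text \<open>Version for an arbitrary threshold, with the radius taken from continuity of the kernel.
  It serves the almost sure statements, where no radius is prescribed. One quarter of
  \<open>e\<close> goes to the noise and one to each of the three oscillation terms.\<close>

lemma tuple_var_small:
  fixes D :: "'a::euclidean_space set"
  assumes k: "pos_def_kernel D k" and "\<Omega> \<subseteq> D" and "finite \<Omega>" and cont: "cond_A3 D \<Omega> k"
    and v: "0 < v" and e: "0 < e"
  obtains T \<nu> where "0 < T" "0 < \<nu>"
    "\<And>x as. x \<in> \<Omega> \<Longrightarrow> length as = T \<Longrightarrow> set as \<subseteq> nbhd D x \<nu> \<Longrightarrow> tuple_var k v as x < e"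
proof -
  obtain T where T: "0 < T" "v / real T < e / 4"
  proof -
    obtain n where "4 * v / e < real n" using reals_Archimedean2 by blast
    then have "4 * v < e * real n" using e by (simp add: pos_divide_less_eq mult.commute)
    then have "v < e / 4 * real (Suc n)" using e by (simp add: algebra_simps)
    then show thesis by (intro that[of "Suc n"]) (simp_all add: pos_divide_less_eq del: of_nat_Suc)
  qed
  have "\<exists>\<nu>>0. \<forall>a\<in>nbhd D x \<nu>. \<forall>b\<in>nbhd D x \<nu>. \<bar>k a b - k x x\<bar> < e / 4" if x: "x \<in> \<Omega>" for x
  proof -
    have "continuous (at (x, x) within D \<times> D) (\<lambda>(a, b). k a b)"
      using cont x by (simp add: cond_A3_def)
    moreover have "0 < e / 4" using e by simp
    ultimately have "\<exists>d>0. \<forall>z\<in>D \<times> D. dist z (x, x) < d \<longrightarrow>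
        dist (case z of (a, b) \<Rightarrow> k a b) (case (x, x) of (a, b) \<Rightarrow> k a b) < e / 4"
      unfolding continuous_within_eps_delta by blast
    then obtain d where d: "0 < d"
      "\<And>z. z \<in> D \<times> D \<Longrightarrow> dist z (x, x) < d \<Longrightarrow> dist (case z of (a, b) \<Rightarrow> k a b) (k x x) < e / 4"
      by auto
    show ?thesis
    proof (intro exI conjI ballI)
      \<comment> \<open>Halving compensates for bounding the distance in the product space by the
        sum of the two coordinate distances.\<close>
      show "0 < d / 2" using d by simp
      fix a b assume ab: "a \<in> nbhd D x (d / 2)" "b \<in> nbhd D x (d / 2)"
      have "dist (a, b) (x, x) \<le> dist a x + dist b x"
        by (simp add: dist_Pair_Pair sqrt_sum_squares_le_sum)
      also have "\<dots> < d" using ab by (simp add: nbhd_def dist_norm)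
      finally show "\<bar>k a b - k x x\<bar> < e / 4"
        using d(2)[of "(a, b)"] ab by (simp add: nbhd_def dist_real_def)
    qed
  qed
  then obtain \<nu> where \<nu>: "\<And>x. x \<in> \<Omega> \<Longrightarrow> 0 < \<nu> x"
    "\<And>x a b. x \<in> \<Omega> \<Longrightarrow> a \<in> nbhd D x (\<nu> x) \<Longrightarrow> b \<in> nbhd D x (\<nu> x) \<Longrightarrow> \<bar>k a b - k x x\<bar> < e / 4"
    by metis
  \<comment> \<open>The inserted 1 keeps the minimum well defined when \<Omega> is empty.\<close>
  define r where "r = Min (insert 1 (\<nu> ` \<Omega>))"
  have r: "0 < r" "\<And>x. x \<in> \<Omega> \<Longrightarrow> r \<le> \<nu> x"
    using \<open>finite \<Omega>\<close> \<nu>(1) by (auto simp: r_def)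
  show thesis
  proof (rule that[OF T(1) r(1)])
    fix x "as" assume x: "x \<in> \<Omega>" and "as": "length as = T" "set as \<subseteq> nbhd D x r"
    then have sub: "set as \<subseteq> nbhd D x (\<nu> x)"
      using r(2)[OF x] by (force simp: nbhd_def)
    have self: "x \<in> nbhd D x (\<nu> x)" using x \<open>\<Omega> \<subseteq> D\<close> \<nu>(1)[OF x] by (auto simp: nbhd_def)
    have "tuple_var k v as x \<le> v / real (length as) + 3 * (e / 4)"
    proof (rule tuple_var_le[OF k])
      show "set as \<subseteq> D" using sub by (auto simp: nbhd_def)
      show "0 < v" "0 < length as" using v T "as" by auto
      show "k x x - e / 4 \<le> k a x" if "a \<in> set as" for a
        using \<nu>(2)[OF x subsetD[OF sub that] self] by linarith
      show "k a b \<le> k x x + e / 4" if "a \<in> set as" "b \<in> set as" for a b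
        using \<nu>(2)[OF x subsetD[OF sub that(1)] subsetD[OF sub that(2)]] by linarith
    qed
    then show "tuple_var k v as x < e" unfolding "as"(1) using T(2) by linarith
  qed
qed


section \<open>Blocks of trials\<close>

lemma prod_one_minus_small:
  assumes A1: "cond_A1 p" and p: "\<forall>t\<ge>1. 0 \<le> p t \<and> p t \<le> 1"
    and q: "0 < q" "q \<le> 1" and e: "0 < e"
  obtains b where "a < b" "(\<Prod>t=a+1..b. 1 - p t * q) < (e::real)"
proof -
  \<comment> \<open>Once the partial sum exceeds \<open>z\<close>, the part of it beyond
    \<open>a\<close> exceeds \<open>- ln e / q\<close>, which is what
    \<open>exp (- q * sum) < e\<close> requires.\<close>
  define z where "z = (\<Sum>t=1..a. p t) - ln e / q"
  have "eventually (\<lambda>n. z < (\<Sum>t=1..n. p t)) sequentially"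
    using A1 unfolding cond_A1_def filterlim_at_top_dense by blast
  then have "eventually (\<lambda>n. z < (\<Sum>t=1..n. p t) \<and> a < n) sequentially"
    using eventually_gt_at_top[of a] by (rule eventually_conj)
  then obtain b where b: "z < (\<Sum>t=1..b. p t)" "a < b"
    by (auto simp: eventually_sequentially)
  obtain d where d: "b = a + d" using b(2) less_imp_add_positive by blast
  have "(\<Sum>t=1..b. p t) = (\<Sum>t=1..a. p t) + (\<Sum>t=a+1..b. p t)"
    unfolding d by (rule sum.ub_add_nat) simp
  then have "- ln e / q < (\<Sum>t=a+1..b. p t)" using b(1) by (simp add: z_def)
  then have "- ln e < q * (\<Sum>t=a+1..b. p t)"
    unfolding pos_divide_less_eq[OF q(1)] by (simp only: mult.commute)
  then have "exp (- (q * (\<Sum>t=a+1..b. p t))) < exp (ln e)" by simp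
  then have small: "exp (- (q * (\<Sum>t=a+1..b. p t))) < e" using e by simp
  \<comment> \<open>Termwise \<open>1 - y \<le> exp (- y)\<close>. Comparing the products also needs
    nonnegative factors, hence the bound \<open>p t * q \<le> 1\<close>.\<close>
  have "(\<Prod>t=a+1..b. 1 - p t * q) \<le> (\<Prod>t=a+1..b. exp (- (q * p t)))"
  proof (rule prod_mono)
    fix t assume "t \<in> {a+1..b}"
    then have "p t * q \<le> 1" using p q by (intro mult_le_one) auto
    then show "0 \<le> 1 - p t * q \<and> 1 - p t * q \<le> exp (- (q * p t))"
      using exp_ge_add_one_self[of "- (q * p t)"] by (simp add: mult.commute)
  qed
  also have "\<dots> = exp (- (q * (\<Sum>t=a+1..b. p t)))"
    by (simp add: exp_sum[symmetric] sum_negf sum_distrib_left)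
  finally show thesis using small b(2) by (intro that[of b]) auto
qed

text \<open>Blocks are built greedily: divergence leaves enough mass beyond any index, so each block
  can begin where the previous one ended.\<close>

lemma trial_blocks_exist:
  assumes A1: "cond_A1 p" and p: "\<forall>t\<ge>1. 0 \<le> p t \<and> p t \<le> 1"
    and q: "0 < q" "q \<le> 1" and d: "0 < \<delta>" and m: "0 < m"
  obtains N where "trial_blocks p q \<delta> m N"
proof -
  have "\<forall>a. \<exists>b>a. (\<Prod>t=a+1..b. 1 - p t * q) < \<delta> / real m"
    using prod_one_minus_small[OF A1 p q, of "\<delta> / real m"] d m by (metis divide_pos_pos of_nat_0_less_iff)
  then obtain b where b: "\<And>a. a < b a" "\<And>a. (\<Prod>t=a+1..b a. 1 - p t * q) < \<delta> / real m"
    by metis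
  define N where "N = rec_nat 0 (\<lambda>_. b)"
  have "N (Suc j) = b (N j)" for j by (simp add: N_def)
  then have "N (j - 1) < N j \<and> (\<Prod>t=N (j - 1) + 1..N j. 1 - p t * q) < \<delta> / real m"
    if "1 \<le> j" for j
    using b that by (cases j) auto
  moreover have "N 0 = 0" by (simp add: N_def)
  ultimately show thesis by (intro that[of N]) (auto simp: trial_blocks_def)
qed

text \<open>With a uniform lower bound \<open>ps\<close> every factor is at most
  \<open>1 - ps * q\<close>, so blocks of equal length suffice. Taking logarithms,
  \<open>(1 - ps * q) ^ r < \<delta> / m\<close> is the inequality that defines
  \<open>block_length\<close>.\<close>

lemma trial_blocks_const:
  assumes A1': "cond_A1' p ps" and p: "\<forall>t\<ge>1. 0 \<le> p t \<and> p t \<le> 1"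
    and q: "0 < q" "q \<le> 1" and d: "0 < \<delta>" and m: "0 < m"
  shows "trial_blocks p q \<delta> m (\<lambda>j. block_length (ps * q) \<delta> m * j)"
proof -
  let ?p = "ps * q" and ?r = "block_length (ps * q) \<delta> m"
  have ps: "0 < ps" "ps < 1" "\<And>t. 1 \<le> t \<Longrightarrow> ps \<le> p t" using A1' by (auto simp: cond_A1'_def)
  have p01: "0 < ?p" "?p < 1"
    using ps q mult_less_le_imp_less[of ps 1 q 1] by auto
  have "0 < ?r \<and> ln (real m / \<delta>) / (- ln (1 - ?p)) < real ?r"
  proof -
    obtain n where "ln (real m / \<delta>) / (- ln (1 - ?p)) < real n" using reals_Archimedean2 by blast
    then have "0 < Suc n \<and> ln (real m / \<delta>) / (- ln (1 - ?p)) < real (Suc n)" by simp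
    then show ?thesis unfolding block_length_def by (rule LeastI)
  qed
  then have r: "0 < ?r" "ln (real m / \<delta>) / (- ln (1 - ?p)) < real ?r" by auto
  have lnneg: "0 < - ln (1 - ?p)" using p01 by simp
  have "ln (real m / \<delta>) < real ?r * (- ln (1 - ?p))"
    using r(2) by (simp only: pos_divide_less_eq[OF lnneg])
  moreover have "ln ((1 - ?p) ^ ?r) = real ?r * ln (1 - ?p)" using p01 by (simp add: ln_realpow)
  moreover have "ln (\<delta> / real m) = - ln (real m / \<delta>)" using d m by (simp add: ln_div)
  ultimately have "ln ((1 - ?p) ^ ?r) < ln (\<delta> / real m)" by simp
  then have small: "(1 - ?p) ^ ?r < \<delta> / real m" using p01 d m by (subst (asm) ln_less_cancel_iff) auto
  have block: "(\<Prod>t=?r * j + 1..?r * Suc j. 1 - p t * q) < \<delta> / real m" for j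
  proof -
    have "(\<Prod>t=?r * j + 1..?r * Suc j. 1 - p t * q) \<le> (\<Prod>t=?r * j + 1..?r * Suc j. 1 - ?p)"
    proof (rule prod_mono)
      fix t assume "t \<in> {?r * j + 1..?r * Suc j}"
      then have "1 \<le> t" by simp
      then have "p t * q \<le> 1" "ps * q \<le> p t * q" using p q ps(3) by (auto intro: mult_le_one)
      then show "0 \<le> 1 - p t * q \<and> 1 - p t * q \<le> 1 - ?p" by simp
    qed
    then show ?thesis using small by simp
  qed
  show ?thesis
    unfolding trial_blocks_def
  proof (intro conjI ballI)
    fix j assume "j \<in> {1..m}"
    then obtain i where "j = Suc i" by (cases j) auto
    then show "?r * (j - 1) < ?r * j"
      and "(\<Prod>t=?r * (j - 1) + 1..?r * j. 1 - p t * q) < \<delta> / real m"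
      using r(1) block[of i] by auto
  qed simp
qed

section \<open>Visits to a neighbourhood in one trial and in a block\<close>

context algorithm_run
begin

lemma space_past: "space (past R t) = space M"
  using past_subalgebra[of t] by (simp add: subalgebra_def)

lemma past_sets: "E \<in> sets (past R t) \<Longrightarrow> E \<in> sets M"
  using past_subalgebra[of t] by (auto simp: subalgebra_def)

lemma past_mono: "s \<le> t \<Longrightarrow> E \<in> sets (past R s) \<Longrightarrow> E \<in> sets (past R t)"
  using sets_F_mono[of s t] by auto

lemma performed_antimono: "performed stop P A R t w \<Longrightarrow> s \<le> t \<Longrightarrow> performed stop P A R s w"
  by (auto simp: performed_def)

text \<open>The event is restricted to runs in which trial \<open>Suc n\<close> still takes place,
  because only there is the law of that trial prescribed. It is nevertheless known after
  \<open>n\<close> trials.\<close>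

definition missed :: "'a set \<Rightarrow> nat \<Rightarrow> nat \<Rightarrow> 'w set" where
  "missed B m n =
    {w \<in> space M. performed stop P A R (Suc n) w \<and> (\<forall>t\<in>{m<..n}. point R t w \<notin> B)}"

abbreviation hit_prob :: "'a set \<Rightarrow> real" where
  "hit_prob B \<equiv> (\<Sum>q\<in>requests A. weight A q * measure (law A q) B)"

lemma point_in_sets:
  assumes "B \<in> sets (restrict_space borel (inputs P))" "1 \<le> t" "t \<le> n"
  shows "{w \<in> space M. point R t w \<in> B} \<in> sets (past R n)"
proof -
  have "point R t -` B \<inter> space (past R t) \<in> sets (past R t)"
    using assms point_measurable by (intro measurable_sets)
  moreover have "point R t -` B \<inter> space (past R t) = {w \<in> space M. point R t w \<in> B}"
    by (auto simp: space_past)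
  ultimately show ?thesis using assms past_mono by metis
qed

lemma missed_measurable:
  assumes B: "B \<in> sets (restrict_space borel (inputs P))"
  shows "missed B m n \<in> sets (past R n)"
proof -
  have "missed B m n = {w \<in> space M. performed stop P A R (Suc n) w}
      - (\<Union>t\<in>{m<..n}. {w \<in> space M. point R t w \<in> B})"
    by (auto simp: missed_def)
  also have "\<dots> \<in> sets (past R n)"
    using point_in_sets[OF B] performed_measurable[of n]
    by (intro sets.Diff sets.finite_UN) auto
  finally show ?thesis .
qed

text \<open>The request chosen by maximization is beyond control, so only outcomes with a true coin
  are counted; there the request is the random draw, independent of the past. Quantifying over past
  events \<open>E\<close> expresses a conditional probability bound.\<close>

lemma prob_point_ge:
  assumes E: "E \<in> sets (past R t)" and perf: "\<And>w. w \<in> E \<Longrightarrow> performed stop P A R (Suc t) w"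
    and B: "B \<in> sets (restrict_space borel (inputs P))"
    and fin: "finite (requests A)" and p: "0 \<le> p (Suc t)" "p (Suc t) \<le> 1"
  shows "prob E * (p (Suc t) * hit_prob B) \<le> prob {w \<in> E. point R (Suc t) w \<in> B}"
proof -
  have Esub: "E \<subseteq> space M" using sets.sets_into_space[OF past_sets[OF E]] .
  \<comment> \<open>Splitting by the drawn request gives disjoint events, each with a single known
    law for the evaluated point.\<close>
  define F where "F q = {w \<in> E. coin R (Suc t) w = True \<and> draw R (Suc t) w = q \<and>
      request R (Suc t) w = q \<and> point R (Suc t) w \<in> B}" for q
  have H: "{w \<in> E. point R (Suc t) w \<in> B} \<in> sets (past R (Suc t))"
  proof -
    have "{w \<in> E. point R (Suc t) w \<in> B} = E \<inter> {w \<in> space M. point R (Suc t) w \<in> B}"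
      using Esub by auto
    then show ?thesis
      using point_in_sets[OF B, of "Suc t" "Suc t"] past_mono[OF _ E, of "Suc t"] by simp
  qed
  have F_sets: "F q \<in> sets M" if q: "q \<in> requests A" for q
  proof -
    have "F q = {w \<in> E. point R (Suc t) w \<in> B}
        \<inter> (coin R (Suc t) -` {True} \<inter> space (past R (Suc t)))
        \<inter> (draw R (Suc t) -` {q} \<inter> space (past R (Suc t)))
        \<inter> (request R (Suc t) -` {q} \<inter> space (past R (Suc t)))"
      using Esub by (auto simp: F_def space_past)
    also have "\<dots> \<in> sets (past R (Suc t))"
    proof (rule sets.Int[OF sets.Int[OF sets.Int[OF H]]])
      show "coin R (Suc t) -` {True} \<inter> space (past R (Suc t)) \<in> sets (past R (Suc t))"
        by (rule measurable_sets[OF coin_measurable]) auto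
      show "draw R (Suc t) -` {q} \<inter> space (past R (Suc t)) \<in> sets (past R (Suc t))"
        by (rule measurable_sets[OF draw_measurable]) (simp_all add: q)
      show "request R (Suc t) -` {q} \<inter> space (past R (Suc t)) \<in> sets (past R (Suc t))"
        by (rule measurable_sets[OF request_measurable]) (simp_all add: q)
    qed
    finally show ?thesis by (rule past_sets)
  qed
  have F_prob: "prob (F q) = prob E * p (Suc t) * (weight A q * measure (law A q) B)"
    if q: "q \<in> requests A" for q
  proof -
    have "prob (F q) = prob {w \<in> E. coin R (Suc t) w = True \<and> draw R (Suc t) w = q \<and>
        request R (Suc t) w = q} * measure (law A q) B"
      unfolding F_def by (rule point_law[OF E perf q q B])
    also have "{w \<in> E. coin R (Suc t) w = True \<and> draw R (Suc t) w = q \<and> request R (Suc t) w = q}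
        = {w \<in> E. coin R (Suc t) w = True \<and> draw R (Suc t) w = q}"
      using request_random[of _ t] perf Esub by auto
    also have "prob \<dots> = prob E * pmf (bernoulli_pmf (p (Suc t))) True * weight A q"
      by (rule coin_draw_law[OF E perf q])
    finally show ?thesis using p by simp
  qed
  have "prob E * (p (Suc t) * hit_prob B) = (\<Sum>q\<in>requests A. prob (F q))"
    by (simp add: F_prob sum_distrib_left mult.assoc)
  also have "\<dots> = prob (\<Union>q\<in>requests A. F q)"
    using F_sets fin
    by (intro finite_measure_finite_Union[symmetric]) (auto simp: disjoint_family_on_def F_def)
  also have "\<dots> \<le> prob {w \<in> E. point R (Suc t) w \<in> B}"
    using past_sets[OF H] by (intro finite_measure_mono) (auto simp: F_def)
  finally show ?thesis .
qed

text \<open>Induction on the end of the block: given that all earlier trials missed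
  \<open>B\<close>, the next one hits it with conditional probability at least
  \<open>p (Suc n) * q\<close>.\<close>

lemma prob_missed_le:
  assumes B: "B \<in> sets (restrict_space borel (inputs P))" and fin: "finite (requests A)"
    and p: "\<forall>t\<ge>1. 0 \<le> p t \<and> p t \<le> 1" and q: "0 \<le> q" "q \<le> 1" "q \<le> hit_prob B"
    and mn: "m \<le> n"
  shows "prob (missed B m n) \<le> (\<Prod>t=m+1..n. 1 - p t * q)"
  using mn
proof (induction n rule: dec_induct)
  case base
  then show ?case by simp
next
  case (step n)
  let ?E = "missed B m n" and ?H = "{w \<in> missed B m n. point R (Suc n) w \<in> B}"
  have E: "?E \<in> sets (past R n)" by (rule missed_measurable[OF B])
  have Esub: "?E \<subseteq> space M" by (auto simp: missed_def)
  have pn: "0 \<le> p (Suc n)" "p (Suc n) \<le> 1" using p by auto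
  have H: "?H \<in> sets M"
  proof -
    have "?H = ?E \<inter> {w \<in> space M. point R (Suc n) w \<in> B}" using Esub by auto
    then show ?thesis
      using past_sets[OF E] past_sets[OF point_in_sets[OF B, of "Suc n" "Suc n"]] by simp
  qed
  \<comment> \<open>Only an inclusion, since a run that avoids \<open>B\<close> may still terminate
    after trial \<open>Suc n\<close>.\<close>
  have "missed B m (Suc n) \<subseteq> ?E - ?H"
    using step.hyps by (auto simp: missed_def intro: performed_antimono)
  then have "prob (missed B m (Suc n)) \<le> prob (?E - ?H)"
    using H past_sets[OF E] by (intro finite_measure_mono) auto
  also have "\<dots> = prob ?E - prob ?H"
    using H past_sets[OF E] by (intro finite_measure_Diff) auto
  also have "\<dots> \<le> prob ?E * (1 - p (Suc n) * q)"
  proof -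
    have "prob ?E * (p (Suc n) * q) \<le> prob ?E * (p (Suc n) * hit_prob B)"
      using q pn by (intro mult_left_mono) auto
    also have "\<dots> \<le> prob ?H"
      by (rule prob_point_ge[OF E _ B fin pn]) (simp add: missed_def)
    finally show ?thesis by (simp add: algebra_simps)
  qed
  also have "\<dots> \<le> (\<Prod>t=m+1..n. 1 - p t * q) * (1 - p (Suc n) * q)"
    using step.IH q pn by (intro mult_right_mono) (auto intro: mult_le_one)
  also have "\<dots> = (\<Prod>t=m+1..Suc n. 1 - p t * q)"
    using step.hyps by (simp add: prod.nat_ivl_Suc')
  finally show ?case .
qed

lemma run_data_in:
  assumes "w \<in> space M" "(q, s, y) \<in> set (run_data R t w)"
  shows "q \<in> requests A \<and> s \<in> inputs P"
proof -
  consider j where "j < init_size R" "init_obs R j w = (q, s, y)"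
    | u where "1 \<le> u" "request R u w = q" "point R u w = s"
    using assms(2) by (auto simp: run_data_def)
  then show ?thesis
  proof cases
    case 1
    then have "(q, s, y) \<in> space (count_space (requests A) \<Otimes>\<^sub>M
        restrict_space borel (inputs P) \<Otimes>\<^sub>M borel)"
      using measurable_space[OF init_measurable, of j w] assms(1) by (simp add: space_past)
    then show ?thesis by (auto simp: space_pair_measure space_restrict_space)
  next
    case 2
    then show ?thesis
      using measurable_space[OF request_measurable, of u w] measurable_space[OF point_measurable, of u w]
        assms(1) by (auto simp: space_past space_restrict_space)
  qed
qed

end

section \<open>Classification and termination of a run\<close>

locale level_set_run = algorithm_run +
  fixes V :: real
  assumes finite_cand: "finite (cand P)" and cand_nonempty: "cand P \<noteq> {}"
    and cand_inputs: "cand P \<subseteq> inputs P" and kernel: "pos_def_kernel (inputs P) (ker P)"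
    and marg_pos: "0 < marg P" and conf_pos: "0 < conf P"
    and finite_requests: "finite (requests A)"
    and nvar_pos: "\<And>q. q \<in> requests A \<Longrightarrow> 0 < nvar A q"
    and nvar_le: "\<And>q. q \<in> requests A \<Longrightarrow> nvar A q \<le> V"
    and p01: "\<forall>t\<ge>1. 0 \<le> p t \<and> p t \<le> 1"
begin

lemma gp_regression_run_data:
  assumes w: "w \<in> space M"
  shows "gp_regression (inputs P) (ker P) (map (\<lambda>(q, s, y). s) (run_data R t w))
    (map (\<lambda>(q, s, y). nvar A q) (run_data R t w))"
proof (rule gp_regression.intro[OF kernel])
  show "set (map (\<lambda>(q, s, y). s) (run_data R t w)) \<subseteq> inputs P"
    using run_data_in[OF w, of _ _ _ t] by auto
  show "0 < v" if "v \<in> set (map (\<lambda>(q, s, y). nvar A q) (run_data R t w))" for v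
    using run_data_in[OF w, of _ _ _ t] nvar_pos that by auto
qed simp

lemma post_var_nonneg:
  "w \<in> space M \<Longrightarrow> x \<in> cand P \<Longrightarrow> 0 \<le> post_var (ker P) (nvar A) (run_data R t w) x"
  unfolding post_var_def
  by (rule gp_regression.gp_cov_nonneg[OF gp_regression_run_data subsetD[OF cand_inputs]])

text \<open>Only the trials \<open>f i\<close> are kept, and their noise variances are replaced by
  the common bound \<open>V\<close>; neither change can lower the variance.\<close>

lemma post_var_le_tuple_var:
  assumes w: "w \<in> space M" and f: "inj_on f {..<T}" and fn: "\<And>i. i < T \<Longrightarrow> f i \<in> {1..n}"
  shows "post_var (ker P) (nvar A) (run_data R n w) x
    \<le> tuple_var (ker P) V (map (\<lambda>i. point R (f i) w) [0..<T]) x"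
proof -
  interpret gp_regression "inputs P" "ker P" "map (\<lambda>(q, s, y). s) (run_data R n w)"
    "map (\<lambda>(q, s, y). nvar A q) (run_data R n w)"
    by (rule gp_regression_run_data[OF w])
  \<comment> \<open>List positions start at 0 and the initial data come first, so trial
    \<open>u\<close> is stored at position \<open>init_size R + (u - 1)\<close>.\<close>
  define f' where "f' i = init_size R + (f i - 1)" for i
  have len: "length (run_data R n w) = init_size R + n" by (simp add: run_data_def)
  have nth: "run_data R n w ! f' i = (request R (f i) w, point R (f i) w, response R (f i) w)"
    and lt: "f' i < init_size R + n" if "i < T" for i
    using fn[OF that] by (auto simp: f'_def run_data_def nth_append simp del: upt_Suc)
  have "post_var (ker P) (nvar A) (run_data R n w) x \<le> tuple_var (ker P) V
      (map (\<lambda>i. map (\<lambda>(q, s, y). s) (run_data R n w) ! f' i) [0..<T]) x"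
    unfolding post_var_def
  proof (rule gp_cov_le_tuple_var)
    show "inj_on f' {..<T}"
    proof (rule inj_onI)
      fix i j assume ij: "i \<in> {..<T}" "j \<in> {..<T}" "f' i = f' j"
      then have "f i = f j" using fn[of i] fn[of j] by (auto simp: f'_def)
      then show "i = j" using f ij by (auto dest: inj_onD)
    qed
    show "f' i < length (map (\<lambda>(q, s, y). s) (run_data R n w))" if "i < T" for i
      using lt[OF that] len by simp
    show "map (\<lambda>(q, s, y). nvar A q) (run_data R n w) ! f' i \<le> V" if "i < T" for i
    proof -
      have "request R (f i) w \<in> requests A"
        using measurable_space[OF request_measurable, of "f i" w] fn[OF that] w
        by (auto simp: space_past)
      then show ?thesis using that lt len by (simp add: nth nvar_le)
    qed
  qed
  also have "map (\<lambda>i. map (\<lambda>(q, s, y). s) (run_data R n w) ! f' i) [0..<T]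
      = map (\<lambda>i. point R (f i) w) [0..<T]"
    using lt len by (auto simp: nth)
  finally show ?thesis .
qed

text \<open>If the lower confidence bound does not exceed \<open>thr P - marg P\<close>, the upper
  one, less than \<open>2 * marg P\<close> above it, is below \<open>thr P + marg P\<close>. The
  condition \<open>1 \<le> t\<close> excludes the initial state, in which every candidate counts as
  unclassified.\<close>

lemma run_unclassified_empty:
  assumes "1 \<le> t"
    and small: "\<And>x. x \<in> cand P \<Longrightarrow>
      post_var (ker P) (nvar A) (run_data R t w) x < (marg P)\<^sup>2 / conf P"
  shows "run_unclassified P A R t w = {}"
proof -
  have "x \<in> high_set P (nvar A) (run_data R t w) \<union> low_set P (nvar A) (run_data R t w)"
    if x: "x \<in> cand P" for x
  proof -
    let ?v = "post_var (ker P) (nvar A) (run_data R t w) x"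
    have "conf P * ?v < (marg P)\<^sup>2"
      using small[OF x] conf_pos by (simp add: pos_less_divide_eq mult.commute)
    then have "sqrt (conf P * ?v) < sqrt ((marg P)\<^sup>2)" by (simp only: real_sqrt_less_iff)
    then have "sqrt (conf P) * sqrt ?v < marg P" using marg_pos by (simp add: real_sqrt_mult)
    then show ?thesis using x by (simp add: high_set_def low_set_def) linarith
  qed
  then show ?thesis
    using assms(1) by (auto simp: run_unclassified_def unclassified_def classified_def)
qed

text \<open>Expresses completion through \<open>performed\<close>, whose measurability is part of
  the model and which already occurs in \<open>missed\<close>.\<close>

lemma completes_after_iff:
  assumes "stop"
  shows "(\<exists>t\<le>n. completes_after P A R t w) \<longleftrightarrow> \<not> performed stop P A R (Suc n) w"
proof
  assume "\<exists>t\<le>n. completes_after P A R t w"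
  then show "\<not> performed stop P A R (Suc n) w"
    using assms by (auto simp: completes_after_def performed_def less_Suc_eq_le)
next
  assume "\<not> performed stop P A R (Suc n) w"
  then obtain u where u: "u \<le> n" "run_unclassified P A R u w = {}"
    using assms by (auto simp: performed_def less_Suc_eq_le)
  define t where "t = (LEAST u. run_unclassified P A R u w = {})"
  have "run_unclassified P A R t w = {}" unfolding t_def using u(2) by (rule LeastI)
  moreover have "t \<le> n" unfolding t_def using Least_le[of _ u] u by (meson order_trans)
  moreover have "\<forall>u<t. run_unclassified P A R u w \<noteq> {}" unfolding t_def using not_less_Least by blast
  ultimately show "\<exists>t\<le>n. completes_after P A R t w" by (auto simp: completes_after_def)
qed

section \<open>Completion probabilities and almost sure limits\<close>

lemma nbhd_sets: "nbhd (inputs P) x \<nu> \<in> sets (restrict_space borel (inputs P))"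
proof -
  have "nbhd (inputs P) x \<nu> = inputs P \<inter> ball x \<nu>"
    by (auto simp: nbhd_def dist_norm norm_minus_commute)
  then show ?thesis by (auto simp: sets_restrict_space)
qed

text \<open>A run still going after \<open>N m\<close> trials must have missed the target of some
  block: otherwise every candidate would have \<open>T\<close> nearby evaluations and be classified.
  The union bound over \<open>m\<close> blocks, each with failure probability at most
  \<open>\<delta> / m\<close>, gives the claim.\<close>

lemma prob_completes_ge:
  assumes stop: "stop"
    and q: "0 \<le> q" "q \<le> 1" "\<And>x. x \<in> cand P \<Longrightarrow> q \<le> hit_prob (nbhd (inputs P) x \<nu>)"
    and T: "0 < T"
    and small: "\<And>x as. x \<in> cand P \<Longrightarrow> length as = T \<Longrightarrow> set as \<subseteq> nbhd (inputs P) x \<nu> \<Longrightarrow>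
      tuple_var (ker P) V as x < (marg P)\<^sup>2 / conf P"
    and m: "m = card (cand P) * T" and blocks: "trial_blocks p q \<delta> m N"
  shows "prob {w \<in> space M. \<exists>t\<le>N m. completes_after P A R t w} \<ge> 1 - \<delta>"
proof -
  obtain e where e: "bij_betw e {0..<card (cand P)} (cand P)"
    using ex_bij_betw_nat_finite[OF finite_cand] by blast
  have m_pos: "0 < m" using T finite_cand cand_nonempty by (simp add: m card_gt_0_iff)
  have N_less: "N (j - 1) < N j" and N_prod: "(\<Prod>t=N (j - 1) + 1..N j. 1 - p t * q) < \<delta> / real m"
    if "j \<in> {1..m}" for j
    using blocks that by (auto simp: trial_blocks_def)
  have N_mono: "N i \<le> N j" if "i \<le> j" "j \<le> m" for i j
    using that
  proof (induction j rule: dec_induct)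
    case (step j)
    then show ?case using N_less[of "Suc j"] by simp
  qed simp
  \<comment> \<open>Consecutive groups of \<open>T\<close> blocks are assigned to the candidates:
    blocks \<open>i * T + 1\<close> to \<open>i * T + T\<close> aim at \<open>e i\<close>.\<close>
  define nb where "nb j = nbhd (inputs P) (e ((j - 1) div T)) \<nu>" for j
  define bad where "bad j = missed (nb j) (N (j - 1)) (N j)" for j
  have e_in: "e ((j - 1) div T) \<in> cand P" if "j \<in> {1..m}" for j
  proof -
    have "(j - 1) div T < card (cand P)"
      using that by (intro less_mult_imp_div_less) (auto simp: m)
    then show ?thesis using bij_betwE[OF e] by simp
  qed
  have bad_sets: "bad j \<in> sets M" for j
    unfolding bad_def nb_def by (intro past_sets[OF missed_measurable] nbhd_sets)
  have bad_prob: "prob (bad j) \<le> \<delta> / real m" if j: "j \<in> {1..m}" for j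
  proof -
    have "prob (bad j) \<le> (\<Prod>t=N (j - 1) + 1..N j. 1 - p t * q)"
      unfolding bad_def nb_def
      by (rule prob_missed_le[OF nbhd_sets finite_requests p01 q(1,2) q(3)[OF e_in[OF j]]])
        (use N_less[OF j] in simp)
    then show ?thesis using N_prod[OF j] by simp
  qed
  let ?U = "{w \<in> space M. performed stop P A R (Suc (N m)) w}"
  have U: "?U \<in> sets M" using past_sets[OF performed_measurable] .
  have "?U \<subseteq> (\<Union>j\<in>{1..m}. bad j)"
  proof
    fix w assume "w \<in> ?U"
    then have w: "w \<in> space M" and perf: "performed stop P A R (Suc (N m)) w" by auto
    show "w \<in> (\<Union>j\<in>{1..m}. bad j)"
    proof (rule ccontr)
      assume not_bad: "w \<notin> (\<Union>j\<in>{1..m}. bad j)"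
      have "\<exists>t\<in>{N (j - 1)<..N j}. point R t w \<in> nb j" if j: "j \<in> {1..m}" for j
      proof -
        have "performed stop P A R (Suc (N j)) w"
          using performed_antimono[OF perf] N_mono[of j m] j by simp
        then show ?thesis using not_bad j w by (auto simp: bad_def missed_def)
      qed
      then obtain \<tau> where \<tau>: "\<And>j. j \<in> {1..m} \<Longrightarrow> \<tau> j \<in> {N (j - 1)<..N j}"
        "\<And>j. j \<in> {1..m} \<Longrightarrow> point R (\<tau> j) w \<in> nb j"
        by metis
      \<comment> \<open>Blocks do not overlap, so the visits selected from different blocks are
        different trials and hence different observations.\<close>
      have \<tau>_less: "\<tau> i < \<tau> j" if "i < j" "i \<in> {1..m}" "j \<in> {1..m}" for i j
      proof -
        have "\<tau> i \<le> N i" "N (j - 1) < \<tau> j" using \<tau>(1) that(2,3) by auto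
        moreover have "N i \<le> N (j - 1)" using that by (intro N_mono) auto
        ultimately show ?thesis by linarith
      qed
      have "run_unclassified P A R (N m) w = {}"
      proof (rule run_unclassified_empty)
        show "1 \<le> N m" using N_less[of m] m_pos by simp
        fix x assume x: "x \<in> cand P"
        then have "x \<in> e ` {0..<card (cand P)}" unfolding bij_betw_imp_surj_on[OF e] .
        then obtain i where i: "i < card (cand P)" "x = e i"
          by (elim imageE) simp
        define f where "f l = \<tau> (i * T + l + 1)" for l
        have idx: "i * T + l + 1 \<in> {1..m}" if "l < T" for l
        proof -
          have "i * T + l + 1 \<le> Suc i * T" using that by simp
          also have "\<dots> \<le> m" unfolding m using i by (intro mult_le_mono1) simp
          finally show ?thesis by simp
        qed
        have "inj_on f {..<T}"
        proof (rule linorder_inj_onI)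
          fix a b assume "a < b" "a \<in> {..<T}" "b \<in> {..<T}"
          then show "f a \<noteq> f b" using \<tau>_less[OF _ idx idx, of a b] by (simp add: f_def)
        qed (simp add: linear)
        moreover have "f l \<in> {1..N m}" if "l < T" for l
          using \<tau>(1)[OF idx[OF that]] N_mono[of "i * T + l + 1" m] idx[OF that] by (auto simp: f_def)
        ultimately have "post_var (ker P) (nvar A) (run_data R (N m) w) x
            \<le> tuple_var (ker P) V (map (\<lambda>l. point R (f l) w) [0..<T]) x"
          by (rule post_var_le_tuple_var[OF w])
        also have "\<dots> < (marg P)\<^sup>2 / conf P"
        proof (rule small[OF x])
          have "point R (f l) w \<in> nbhd (inputs P) x \<nu>" if "l < T" for l
            using \<tau>(2)[OF idx[OF that]] that by (simp add: f_def nb_def i(2) T)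
          then show "set (map (\<lambda>l. point R (f l) w) [0..<T]) \<subseteq> nbhd (inputs P) x \<nu>" by auto
        qed simp
        finally show "post_var (ker P) (nvar A) (run_data R (N m) w) x < (marg P)\<^sup>2 / conf P" .
      qed
      \<comment> \<open>Performing trial \<open>Suc (N m)\<close> requires a candidate still
        unclassified after \<open>N m\<close> trials.\<close>
      then show False using perf stop by (auto simp: performed_def)
    qed
  qed
  then have "prob ?U \<le> prob (\<Union>j\<in>{1..m}. bad j)"
    using bad_sets by (intro finite_measure_mono) auto
  also have "\<dots> \<le> (\<Sum>j=1..m. prob (bad j))"
    using bad_sets by (intro finite_measure_subadditive_finite) auto
  also have "\<dots> \<le> (\<Sum>j=1..m. \<delta> / real m)" by (intro sum_mono bad_prob)
  also have "\<dots> = \<delta>" using m_pos by simp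
  finally have "prob ?U \<le> \<delta>" .
  moreover have "{w \<in> space M. \<exists>t\<le>N m. completes_after P A R t w} = space M - ?U"
    by (auto simp: completes_after_iff[OF stop])
  ultimately show ?thesis using prob_compl[OF U] by simp
qed

text \<open>For every positive \<open>\<delta>\<close> suitable blocks exist, so completion has
  probability at least \<open>1 - \<delta>\<close>; letting \<open>\<delta>\<close> tend to 0 gives
  probability 1.\<close>

lemma AE_completes:
  assumes stop: "stop" and A1: "cond_A1 p"
    and q: "0 < q" "q \<le> 1" "\<And>x. x \<in> cand P \<Longrightarrow> q \<le> hit_prob (nbhd (inputs P) x \<nu>)"
    and T: "0 < T"
    and small: "\<And>x as. x \<in> cand P \<Longrightarrow> length as = T \<Longrightarrow> set as \<subseteq> nbhd (inputs P) x \<nu> \<Longrightarrow>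
      tuple_var (ker P) V as x < (marg P)\<^sup>2 / conf P"
  shows "AE w in M. \<exists>t. completes_after P A R t w"
proof -
  let ?C = "{w \<in> space M. \<exists>t. completes_after P A R t w}"
  have "(\<exists>t. completes_after P A R t w) \<longleftrightarrow> (\<exists>n. \<not> performed stop P A R (Suc n) w)" for w
    unfolding completes_after_iff[OF stop, symmetric] by blast
  then have "?C = (\<Union>n. space M - {w \<in> space M. performed stop P A R (Suc n) w})"
    by auto
  also have "\<dots> \<in> sets M"
    using past_sets[OF performed_measurable] by (intro sets.countable_UN) auto
  finally have C: "?C \<in> sets M" .
  have m_pos: "0 < card (cand P) * T" using T finite_cand cand_nonempty by (simp add: card_gt_0_iff)
  have "1 \<le> prob ?C + \<delta>" if \<delta>: "0 < \<delta>" for \<delta>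
  proof -
    obtain N where N: "trial_blocks p q \<delta> (card (cand P) * T) N"
      using trial_blocks_exist[OF A1 p01 q(1,2) \<delta> m_pos] by blast
    have "1 - \<delta> \<le> prob {w \<in> space M. \<exists>t\<le>N (card (cand P) * T). completes_after P A R t w}"
      using prob_completes_ge[OF stop less_imp_le[OF q(1)] q(2,3) T small refl N] by blast
    also have "\<dots> \<le> prob ?C" using C by (intro finite_measure_mono) auto
    finally show ?thesis by simp
  qed
  then have "1 \<le> prob ?C" by (rule field_le_epsilon)
  then have "prob ?C = 1" using prob_le_1[of ?C] by linarith
  then have "AE w in M. w \<in> ?C" by (rule AE_prob_1)
  then show ?thesis by (rule AE_mp) auto
qed

text \<open>Without termination every trial is performed. Avoiding the ball forever after trial
  \<open>m\<close> is bounded by products that become arbitrarily small, so it is a null event, and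
  countably many \<open>m\<close> yield infinitely many visits.\<close>

lemma AE_points_visited:
  assumes nstop: "\<not> stop" and A1: "cond_A1 p"
    and q: "0 < q" "q \<le> 1" "q \<le> hit_prob (nbhd (inputs P) x \<nu>)"
  shows "AE w in M. infinite {t. 1 \<le> t \<and> point R t w \<in> nbhd (inputs P) x \<nu>}"
proof -
  let ?B = "nbhd (inputs P) x \<nu>"
  have "AE w in M. \<exists>t>m. point R t w \<in> ?B" for m
  proof -
    let ?Z = "\<Inter>n. missed ?B m n"
    have Z: "?Z \<in> sets M"
      using past_sets[OF missed_measurable[OF nbhd_sets]] by (intro sets.countable_INT) auto
    have "prob ?Z \<le> 0 + e" if e: "0 < e" for e
    proof -
      obtain b where b: "m < b" "(\<Prod>t=m+1..b. 1 - p t * q) < e"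
        using prod_one_minus_small[OF A1 p01 q(1,2) e] by blast
      have "prob ?Z \<le> prob (missed ?B m b)"
        using past_sets[OF missed_measurable[OF nbhd_sets]] by (intro finite_measure_mono) auto
      also have "\<dots> \<le> (\<Prod>t=m+1..b. 1 - p t * q)"
        using b q by (intro prob_missed_le nbhd_sets finite_requests p01) auto
      finally show ?thesis using b by simp
    qed
    then have "prob ?Z \<le> 0" by (rule field_le_epsilon)
    then have "prob ?Z = 0" using measure_nonneg[of M ?Z] by linarith
    then have AE_Z: "AE w in M. w \<notin> ?Z" using Z prob_eq_0 by blast
    have visit: "\<exists>t>m. point R t w \<in> ?B" if w: "w \<in> space M" and Z: "w \<notin> ?Z" for w
    proof -
      obtain n where "w \<notin> missed ?B m n" using Z by auto
      moreover have "performed stop P A R (Suc n) w" using nstop by (simp add: performed_def)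
      ultimately have "\<exists>t\<in>{m<..n}. point R t w \<in> ?B" using w unfolding missed_def by blast
      then show ?thesis by auto
    qed
    show ?thesis by (rule AE_mp[OF AE_Z], intro AE_I2 impI, rule visit)
  qed
  then have "AE w in M. \<forall>m. \<exists>t>m. point R t w \<in> ?B" by (simp add: AE_all_countable)
  then show ?thesis
  proof (rule AE_mp, intro AE_I2 impI)
    fix w assume *: "\<forall>m. \<exists>t>m. point R t w \<in> ?B"
    have "\<forall>m. \<exists>n>m. n \<in> {t. 1 \<le> t \<and> point R t w \<in> ?B}"
    proof
      fix m
      obtain t where "m < t" "point R t w \<in> ?B" using * by blast
      then show "\<exists>n>m. n \<in> {t. 1 \<le> t \<and> point R t w \<in> ?B}" by (intro exI[of _ t]) simp
    qed
    then show "infinite {t. 1 \<le> t \<and> point R t w \<in> ?B}"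
      unfolding infinite_nat_iff_unbounded .
  qed
qed

lemma AE_post_var_tendsto_0:
  assumes nstop: "\<not> stop" and A1: "cond_A1 p"
    and A3: "cond_A3 (inputs P) (cand P) (ker P)"
    and hits: "\<And>\<nu>. 0 < \<nu> \<Longrightarrow> \<exists>q>0. q \<le> 1 \<and> (\<forall>x\<in>cand P. q \<le> hit_prob (nbhd (inputs P) x \<nu>))"
    and V: "0 < V"
  shows "AE w in M. \<forall>x\<in>cand P. (\<lambda>t. post_var (ker P) (nvar A) (run_data R t w) x) \<longlonglongrightarrow> 0"
proof -
  have "AE w in M. eventually (\<lambda>t. post_var (ker P) (nvar A) (run_data R t w) x < 1 / real (Suc n)) sequentially"
    if x: "x \<in> cand P" for x n
  proof -
    obtain T \<nu> where T: "0 < T" and \<nu>: "0 < \<nu>" and small: "\<And>x as. x \<in> cand P \<Longrightarrow> length as = T \<Longrightarrow>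
        set as \<subseteq> nbhd (inputs P) x \<nu> \<Longrightarrow> tuple_var (ker P) V as x < 1 / real (Suc n)"
      using tuple_var_small[OF kernel cand_inputs finite_cand A3 V, of "1 / real (Suc n)"] by auto
    obtain q where q: "0 < q" "q \<le> 1" "q \<le> hit_prob (nbhd (inputs P) x \<nu>)"
      using hits[OF \<nu>] x by blast
    show ?thesis
    proof (rule AE_mp[OF AE_points_visited[OF nstop A1 q]], intro AE_I2 impI)
      fix w assume w: "w \<in> space M"
        and "infinite {t. 1 \<le> t \<and> point R t w \<in> nbhd (inputs P) x \<nu>}"
      then obtain f :: "nat \<Rightarrow> nat" where f: "inj f"
        "range f \<subseteq> {t. 1 \<le> t \<and> point R t w \<in> nbhd (inputs P) x \<nu>}"
        using infinite_countable_subset by blast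
      \<comment> \<open>Once \<open>t\<close> reaches the latest of the \<open>T\<close> selected
        visits, all of them are among the data; further data cannot spoil the bound.\<close>
      have "post_var (ker P) (nvar A) (run_data R t w) x < 1 / real (Suc n)"
        if t: "Max (f ` {..<T}) \<le> t" for t
      proof -
        have "f l \<in> {1..t}" if "l < T" for l
        proof -
          have "f l \<le> Max (f ` {..<T})" using that by (intro Max_ge) auto
          moreover have "1 \<le> f l" using f(2) by auto
          ultimately show ?thesis using t by simp
        qed
        then have "post_var (ker P) (nvar A) (run_data R t w) x
            \<le> tuple_var (ker P) V (map (\<lambda>l. point R (f l) w) [0..<T]) x"
          using inj_on_subset[OF f(1)] by (intro post_var_le_tuple_var[OF w]) auto
        also have "\<dots> < 1 / real (Suc n)"
          using f(2) by (intro small[OF x]) auto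
        finally show ?thesis .
      qed
      then show "eventually (\<lambda>t. post_var (ker P) (nvar A) (run_data R t w) x < 1 / real (Suc n)) sequentially"
        unfolding eventually_sequentially by blast
    qed
  qed
  \<comment> \<open>Finitely many candidates and the countable family of thresholds
    \<open>1 / Suc n\<close> allow one common null set.\<close>
  then have "AE w in M. \<forall>x\<in>cand P. \<forall>n.
      eventually (\<lambda>t. post_var (ker P) (nvar A) (run_data R t w) x < 1 / real (Suc n)) sequentially"
    by (intro AE_finite_allI finite_cand) (simp only: AE_all_countable, blast)
  then show ?thesis
  proof (rule AE_mp, intro AE_I2 impI ballI)
    fix w x assume w: "w \<in> space M" and x: "x \<in> cand P"
      and ev: "\<forall>x\<in>cand P. \<forall>n. eventually (\<lambda>t. post_var (ker P) (nvar A) (run_data R t w) x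
        < 1 / real (Suc n)) sequentially"
    show "(\<lambda>t. post_var (ker P) (nvar A) (run_data R t w) x) \<longlonglongrightarrow> 0"
    proof (rule order_tendstoI)
      fix a :: real assume "a < 0"
      then show "eventually (\<lambda>t. a < post_var (ker P) (nvar A) (run_data R t w) x) sequentially"
        using post_var_nonneg[OF w x] by (intro always_eventually allI) (meson less_le_trans)
    next
      fix a :: real assume "0 < a"
      then obtain n where "1 / real (Suc n) < a" using nat_approx_posE by blast
      then show "eventually (\<lambda>t. post_var (ker P) (nvar A) (run_data R t w) x < a) sequentially"
        using ev x by (auto elim!: eventually_mono dest!: bspec spec[of _ n])
    qed
  qed
qed

end


section \<open>The two algorithms\<close>

lemma (in level_set_run) prob_completes_good_radius:
  assumes "stop" and V: "0 < V"
    and q: "0 \<le> q" "q \<le> 1" "\<And>x. x \<in> cand P \<Longrightarrow> q \<le> hit_prob (nbhd (inputs P) x \<nu>)"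
    and T: "T = visits_needed (conf P) V (marg P)" and m: "m = card (cand P) * T"
    and rad: "good_radius (inputs P) (cand P) (ker P) (conf P) (marg P) V T \<nu>"
    and blocks: "trial_blocks p q \<delta> m N"
  shows "prob {w \<in> space M. \<exists>t\<le>N m. completes_after P A R t w} \<ge> 1 - \<delta>"
proof (rule prob_completes_ge[OF \<open>stop\<close> q _ _ m blocks])
  show "0 < T" unfolding T by (rule visits_needed(1))
  fix x "as" assume "x \<in> cand P" "length as = T" "set as \<subseteq> nbhd (inputs P) x \<nu>"
  then show "tuple_var (ker P) V as x < (marg P)\<^sup>2 / conf P"
    using good_radius_tuple_var[OF kernel cand_inputs conf_pos marg_pos V rad[unfolded T]] T by simp
qed

text \<open>The propositional variables \<open>can_hit\<close> and \<open>kernel_cont\<close> stand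
  for (A2) and (A3), so that one instance per algorithm has the shape of the final claims.\<close>

lemma completion_bounds:
  fixes A :: "('q, 'a::euclidean_space) scheme" and P :: "'a level_set_problem"
  assumes run: "\<And>(M :: 'w measure) R.
      algorithm_run True P A p M R \<Longrightarrow> level_set_run True P A p M R V"
    and P: "finite (cand P)" "cand P \<noteq> {}" and p: "\<forall>t\<ge>1. 0 \<le> p t \<and> p t \<le> 1" and V: "0 < V"
    and q: "can_hit \<Longrightarrow> 0 < q" "q \<le> 1" "\<And>x. x \<in> cand P \<Longrightarrow>
      q \<le> (\<Sum>r\<in>requests A. weight A r * measure (law A r) (nbhd (inputs P) x \<nu>))"
    and T: "T = visits_needed (conf P) V (marg P)" and m: "m = card (cand P) * T"
    and rad: "good_radius (inputs P) (cand P) (ker P) (conf P) (marg P) V T \<nu>" and d: "0 < \<delta>"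
  shows "(can_hit \<longrightarrow> 0 < q) \<and>
    (cond_A1 p \<and> can_hit \<and> kernel_cont \<longrightarrow>
       (\<exists>N. trial_blocks p q \<delta> m N) \<and>
       (\<forall>N. trial_blocks p q \<delta> m N \<longrightarrow>
          (\<forall>(M :: 'w measure) R. algorithm_run True P A p M R \<longrightarrow>
             \<P>(w in M. \<exists>t\<le>N m. completes_after P A R t w) \<ge> 1 - \<delta>))) \<and>
    (\<forall>ps. cond_A1' p ps \<and> can_hit \<and> kernel_cont \<longrightarrow>
       (\<forall>(M :: 'w measure) R. algorithm_run True P A p M R \<longrightarrow>
          \<P>(w in M. \<exists>t\<le>block_length (ps * q) \<delta> m * m. completes_after P A R t w) \<ge> 1 - \<delta>))"
proof -
  have m_pos: "0 < m" using P visits_needed(1) by (simp add: m T card_gt_0_iff)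
  have main: "\<P>(w in M. \<exists>t\<le>N m. completes_after P A R t w) \<ge> 1 - \<delta>"
    if "can_hit" "trial_blocks p q \<delta> m N" "algorithm_run True P A p M R"
    for N and M :: "'w measure" and R
    using level_set_run.prob_completes_good_radius[OF run[OF that(3)] TrueI V
        less_imp_le[OF q(1)[OF that(1)]] q(2,3) T m rad that(2)] by simp
  have ex: "\<exists>N. trial_blocks p q \<delta> m N" if "cond_A1 p" "can_hit"
    using trial_blocks_exist[OF that(1) p q(1)[OF that(2)] q(2) d m_pos] by blast
  have const: "\<P>(w in M. \<exists>t\<le>block_length (ps * q) \<delta> m * m. completes_after P A R t w) \<ge> 1 - \<delta>"
    if "can_hit" "cond_A1' p ps" "algorithm_run True P A p M R" for ps and M :: "'w measure" and R
    by (rule main[OF that(1) trial_blocks_const[OF that(2) p q(1)[OF that(1)] q(2) d m_pos] that(3)])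
  show ?thesis using q(1) main ex const by blast
qed

section \<open>The minimal hitting probability\<close>

lemma min_hit_prob_le:
  assumes "finite \<Omega>" "x \<in> \<Omega>"
  shows "min_hit_prob D \<Omega> n S \<kappa> \<nu> \<le> (\<Sum>a\<in>\<Omega>. \<Sum>i=1..n. \<kappa> i * measure (S a i) (nbhd D x \<nu>))"
  unfolding min_hit_prob_def using assms by (intro Min_le) auto

text \<open>By (A2) each candidate's sum has a positive term, and the minimum is over a finite
  nonempty set.\<close>

lemma min_hit_prob_pos:
  assumes \<Omega>: "finite \<Omega>" "\<Omega> \<noteq> {}" and A2: "cond_A2 D \<Omega> n S" and "0 < \<nu>"
    and \<kappa>: "\<forall>i\<in>{1..n}. 0 < \<kappa> i"
  shows "0 < min_hit_prob D \<Omega> n S \<kappa> \<nu>"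
proof -
  have "0 < (\<Sum>a\<in>\<Omega>. \<Sum>i=1..n. \<kappa> i * measure (S a i) (nbhd D x \<nu>))" if "x \<in> \<Omega>" for x
  proof -
    have nonneg: "0 \<le> \<kappa> i * measure (S a i) (nbhd D x \<nu>)" if "i \<in> {1..n}" for a i
      using \<kappa> that by (simp add: less_imp_le)
    obtain a i where ai: "a \<in> \<Omega>" "i \<in> {1..n}" "0 < measure (S a i) (nbhd D x \<nu>)"
      using A2 \<open>x \<in> \<Omega>\<close> \<open>0 < \<nu>\<close> unfolding cond_A2_def by blast
    have "0 < (\<Sum>i=1..n. \<kappa> i * measure (S a i) (nbhd D x \<nu>))"
      using ai \<kappa> nonneg by (intro sum_pos2[of _ i]) auto
    then show ?thesis
      using ai \<Omega> nonneg by (intro sum_pos2[of _ a]) (auto intro: sum_nonneg)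
  qed
  then show ?thesis unfolding min_hit_prob_def using \<Omega> by (subst Min_gr_iff) auto
qed

text \<open>The weights of all requests add up to 1. The bound keeps the factors
  \<open>1 - p t * q\<close> nonnegative.\<close>

lemma min_hit_prob_le_1:
  assumes \<Omega>: "finite \<Omega>" "\<Omega> \<noteq> {}"
    and S: "\<forall>x\<in>\<Omega>. \<forall>i\<in>{1..n}. prob_space (S x i) \<and> sets (S x i) = sets (restrict_space borel D)"
    and \<kappa>: "\<forall>i\<in>{1..n}. 0 < \<kappa> i" and sum: "real (card \<Omega>) * (\<Sum>i=1..n. \<kappa> i) = 1"
  shows "min_hit_prob D \<Omega> n S \<kappa> \<nu> \<le> 1"
proof -
  obtain x where x: "x \<in> \<Omega>" using \<Omega> by blast
  have "min_hit_prob D \<Omega> n S \<kappa> \<nu> \<le> (\<Sum>a\<in>\<Omega>. \<Sum>i=1..n. \<kappa> i * measure (S a i) (nbhd D x \<nu>))"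
    using \<Omega>(1) x by (rule min_hit_prob_le)
  also have "\<dots> \<le> (\<Sum>a\<in>\<Omega>. \<Sum>i=1..n. \<kappa> i * 1)"
    using S \<kappa> by (intro sum_mono mult_left_mono) (auto simp: prob_space.prob_le_1 less_imp_le)
  also have "\<dots> = 1" using sum by simp
  finally show ?thesis .
qed

section \<open>Application to Algorithms 1 and 2\<close>

theorem theorem7:
  fixes D \<Omega> :: "'a::euclidean_space set"
    and k :: "'a \<Rightarrow> 'a \<Rightarrow> real"
    and h \<epsilon> \<beta> \<sigma> :: real
    and K kout :: nat
    and c cout \<sigma>out \<kappa> p :: "nat \<Rightarrow> real"
    and \<kappa>out :: "nat \<Rightarrow> nat \<Rightarrow> real"
    and S :: "'a \<Rightarrow> nat \<Rightarrow> 'a measure"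
    and gh1 :: "nat \<Rightarrow> ('a \<times> nat, 'a) data \<Rightarrow> 'a \<Rightarrow> nat \<Rightarrow> 'a \<Rightarrow> real"
    and gh2 :: "nat \<Rightarrow> ('a \<times> nat \<times> nat, 'a) data \<Rightarrow> 'a \<Rightarrow> nat \<Rightarrow> 'a \<Rightarrow> real"
  defines "P \<equiv> level_set_problem D \<Omega> k h \<epsilon> \<beta>"
    and "A1 \<equiv> scheme1 \<Omega> K c S gh1 \<sigma> \<kappa>"
    and "A2 \<equiv> scheme2 \<Omega> K c S gh2 kout cout \<sigma>out \<kappa>out"
    and "\<sigma>t2 \<equiv> Max ((\<lambda>j. (\<sigma>out j)\<^sup>2) ` {1..kout})"
  assumes "finite \<Omega>" and "\<Omega> \<noteq> {}" and "\<Omega> \<subseteq> D"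
    and "pos_def_kernel D k"
    and "\<epsilon> > 0" and "\<beta> > 0" and "\<sigma> > 0"
    and "1 \<le> K" and "\<forall>i\<in>{1..K}. 0 < c i" and "strict_mono_on {1..K} c"
    and "1 \<le> kout" and "\<forall>j\<in>{1..kout}. 0 < cout j" and "strict_mono_on {1..kout} cout"
    and "\<forall>j\<in>{1..kout}. 0 < \<sigma>out j"
    and "\<forall>x\<in>\<Omega>. \<forall>i\<in>{1..K}. prob_space (S x i) \<and> sets (S x i) = sets (restrict_space borel D)"
    and "\<forall>t\<ge>1. 0 \<le> p t \<and> p t \<le> 1"
    and "\<forall>i\<in>{1..K}. 0 < \<kappa> i \<and> \<kappa> i < 1"
    and "real (card \<Omega>) * (\<Sum>i=1..K. \<kappa> i) = 1"
    and "\<forall>i\<in>{1..K}. \<forall>j\<in>{1..kout}. 0 < \<kappa>out i j \<and> \<kappa>out i j < 1"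
    and "real (card \<Omega>) * (\<Sum>i=1..K. \<Sum>j=1..kout. \<kappa>out i j) = 1"
  shows
    "(cond_A1 p \<and> cond_A2 D \<Omega> K S \<and> cond_A3 D \<Omega> k \<longrightarrow>
       (\<forall>(M :: 'w measure) R. algorithm_run False P A1 p M R \<longrightarrow>
          (AE w in M. \<forall>x\<in>\<Omega>. (\<lambda>t. post_var k (nvar A1) (run_data R t w) x) \<longlonglongrightarrow> 0)) \<and>
       (\<forall>(M :: 'w measure) R. algorithm_run True P A1 p M R \<longrightarrow>
          (AE w in M. \<exists>t. completes_after P A1 R t w)))
     \<and>
     (\<forall>\<delta> \<nu>. let T = visits_needed \<beta> (\<sigma>\<^sup>2) \<epsilon>; m = card \<Omega> * T; pt = min_hit_prob D \<Omega> K S \<kappa> \<nu> in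
        0 < \<delta> \<and> \<delta> < 1 \<and> good_radius D \<Omega> k \<beta> \<epsilon> (\<sigma>\<^sup>2) T \<nu> \<longrightarrow>
        (cond_A2 D \<Omega> K S \<longrightarrow> 0 < pt) \<and>
        (cond_A1 p \<and> cond_A2 D \<Omega> K S \<and> cond_A3 D \<Omega> k \<longrightarrow>
           (\<exists>N. trial_blocks p pt \<delta> m N) \<and>
           (\<forall>N. trial_blocks p pt \<delta> m N \<longrightarrow>
              (\<forall>(M :: 'w measure) R. algorithm_run True P A1 p M R \<longrightarrow>
                 \<P>(w in M. \<exists>t\<le>N m. completes_after P A1 R t w) \<ge> 1 - \<delta>))) \<and>
        (\<forall>ps. cond_A1' p ps \<and> cond_A2 D \<Omega> K S \<and> cond_A3 D \<Omega> k \<longrightarrow>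
           (\<forall>(M :: 'w measure) R. algorithm_run True P A1 p M R \<longrightarrow>
              \<P>(w in M. \<exists>t\<le>block_length (ps * pt) \<delta> m * m. completes_after P A1 R t w) \<ge> 1 - \<delta>)))
     \<and>
     (\<forall>\<delta> \<nu>. let T = visits_needed \<beta> \<sigma>t2 \<epsilon>; m = card \<Omega> * T;
              ph = min_hit_prob D \<Omega> K S (\<lambda>i. \<Sum>j=1..kout. \<kappa>out i j) \<nu> in
        0 < \<delta> \<and> \<delta> < 1 \<and> good_radius D \<Omega> k \<beta> \<epsilon> \<sigma>t2 T \<nu> \<longrightarrow>
        (cond_A2 D \<Omega> K S \<longrightarrow> 0 < ph) \<and>
        (cond_A1 p \<and> cond_A2 D \<Omega> K S \<and> cond_A3 D \<Omega> k \<longrightarrow>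
           (\<exists>N. trial_blocks p ph \<delta> m N) \<and>
           (\<forall>N. trial_blocks p ph \<delta> m N \<longrightarrow>
              (\<forall>(M :: 'w measure) R. algorithm_run True P A2 p M R \<longrightarrow>
                 \<P>(w in M. \<exists>t\<le>N m. completes_after P A2 R t w) \<ge> 1 - \<delta>))) \<and>
        (\<forall>ps. cond_A1' p ps \<and> cond_A2 D \<Omega> K S \<and> cond_A3 D \<Omega> k \<longrightarrow>
           (\<forall>(M :: 'w measure) R. algorithm_run True P A2 p M R \<longrightarrow>
              \<P>(w in M. \<exists>t\<le>block_length (ps * ph) \<delta> m * m. completes_after P A2 R t w) \<ge> 1 - \<delta>)))"
proof -
  note \<Omega> = \<open>finite \<Omega>\<close> \<open>\<Omega> \<noteq> {}\<close> and S = \<open>\<forall>x\<in>\<Omega>. \<forall>i\<in>{1..K}. prob_space (S x i) \<and> sets (S x i) = sets (restrict_space borel D)\<close>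
    and p = \<open>\<forall>t\<ge>1. 0 \<le> p t \<and> p t \<le> 1\<close>
  let ?\<kappa>2 = "\<lambda>i. \<Sum>j=1..kout. \<kappa>out i j"
  have P: "inputs P = D" "cand P = \<Omega>" "ker P = k" "marg P = \<epsilon>" "conf P = \<beta>"
    by (simp_all add: P_def level_set_problem_def)
  have \<kappa>1: "\<forall>i\<in>{1..K}. 0 < \<kappa> i"
    using \<open>\<forall>i\<in>{1..K}. 0 < \<kappa> i \<and> \<kappa> i < 1\<close> by blast
  have \<kappa>2: "\<forall>i\<in>{1..K}. 0 < ?\<kappa>2 i"
    using \<open>1 \<le> kout\<close> \<open>\<forall>i\<in>{1..K}. \<forall>j\<in>{1..kout}. 0 < \<kappa>out i j \<and> \<kappa>out i j < 1\<close>
    by (auto intro!: sum_pos)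
  have hit1: "(\<Sum>r\<in>requests A1. weight A1 r * measure (law A1 r) B)
      = (\<Sum>a\<in>\<Omega>. \<Sum>i=1..K. \<kappa> i * measure (S a i) B)" for B
    by (simp add: A1_def scheme1_def sum.cartesian_product case_prod_unfold)
  \<comment> \<open>The output cost does not influence where the function is evaluated, so summing
    it out leaves the marginal weights \<open>?\<kappa>2\<close>.\<close>
  have hit2: "(\<Sum>r\<in>requests A2. weight A2 r * measure (law A2 r) B)
      = (\<Sum>a\<in>\<Omega>. \<Sum>i=1..K. ?\<kappa>2 i * measure (S a i) B)" for B
    by (simp add: A2_def scheme2_def sum_distrib_right sum.cartesian_product case_prod_unfold)
  have \<sigma>t2: "(\<sigma>out j)\<^sup>2 \<le> \<sigma>t2" if "j \<in> {1..kout}" for j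
    unfolding \<sigma>t2_def using that by (intro Max_ge) auto
  have V2: "0 < \<sigma>t2"
  proof -
    have "0 < (\<sigma>out 1)\<^sup>2"
      using \<open>\<forall>j\<in>{1..kout}. 0 < \<sigma>out j\<close> \<open>1 \<le> kout\<close> by (intro zero_less_power) auto
    also have "\<dots> \<le> \<sigma>t2" using \<open>1 \<le> kout\<close> by (intro \<sigma>t2) simp
    finally show ?thesis .
  qed
  have lsr1: "level_set_run st P A1 p M R (\<sigma>\<^sup>2)" if "algorithm_run st P A1 p M R"
    for st and M :: "'w measure" and R
    using \<Omega> \<open>\<Omega> \<subseteq> D\<close> \<open>pos_def_kernel D k\<close> \<open>\<epsilon> > 0\<close> \<open>\<beta> > 0\<close> \<open>\<sigma> > 0\<close> p
    by (intro level_set_run.intro[OF that] level_set_run_axioms.intro)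
      (simp_all add: P A1_def scheme1_def)
  have lsr2: "level_set_run st P A2 p M R \<sigma>t2" if "algorithm_run st P A2 p M R"
    for st and M :: "'w measure" and R
  proof (intro level_set_run.intro[OF that] level_set_run_axioms.intro)
    fix q assume "q \<in> requests A2"
    then obtain x i j where q: "q = (x, i, j)" and j: "j \<in> {1..kout}"
      by (auto simp: A2_def scheme2_def)
    show "nvar A2 q \<le> \<sigma>t2" using \<sigma>t2[OF j] by (simp add: q A2_def scheme2_def)
    have "0 < \<sigma>out j" using j \<open>\<forall>j\<in>{1..kout}. 0 < \<sigma>out j\<close> by blast
    then show "0 < nvar A2 q" by (simp add: q A2_def scheme2_def)
  qed (use \<Omega> \<open>\<Omega> \<subseteq> D\<close> \<open>pos_def_kernel D k\<close> \<open>\<epsilon> > 0\<close> \<open>\<beta> > 0\<close> p in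
      \<open>simp_all add: P A2_def scheme2_def\<close>)
  let ?q1 = "min_hit_prob D \<Omega> K S \<kappa>" and ?q2 = "min_hit_prob D \<Omega> K S ?\<kappa>2"
  have q1: "cond_A2 D \<Omega> K S \<Longrightarrow> 0 < \<nu> \<Longrightarrow> 0 < ?q1 \<nu>" "?q1 \<nu> \<le> 1"
    "x \<in> cand P \<Longrightarrow> ?q1 \<nu> \<le> (\<Sum>r\<in>requests A1. weight A1 r * measure (law A1 r) (nbhd (inputs P) x \<nu>))"
    for x \<nu>
    unfolding hit1 P
    by (rule min_hit_prob_pos[OF \<Omega> _ _ \<kappa>1], assumption+)
      (rule min_hit_prob_le_1[OF \<Omega> S \<kappa>1 \<open>real (card \<Omega>) * (\<Sum>i=1..K. \<kappa> i) = 1\<close>],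
        rule min_hit_prob_le[OF \<Omega>(1)], assumption)
  have q2: "cond_A2 D \<Omega> K S \<Longrightarrow> 0 < \<nu> \<Longrightarrow> 0 < ?q2 \<nu>" "?q2 \<nu> \<le> 1"
    "x \<in> cand P \<Longrightarrow> ?q2 \<nu> \<le> (\<Sum>r\<in>requests A2. weight A2 r * measure (law A2 r) (nbhd (inputs P) x \<nu>))"
    for x \<nu>
    unfolding hit2 P
    by (rule min_hit_prob_pos[OF \<Omega> _ _ \<kappa>2], assumption+)
      (rule min_hit_prob_le_1[OF \<Omega> S \<kappa>2 \<open>real (card \<Omega>) * (\<Sum>i=1..K. \<Sum>j=1..kout. \<kappa>out i j) = 1\<close>],
        rule min_hit_prob_le[OF \<Omega>(1)], assumption)
  have V1: "0 < \<sigma>\<^sup>2" using \<open>\<sigma> > 0\<close> by simp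
  have finP: "finite (cand P)" "cand P \<noteq> {}" using \<Omega> by (simp_all add: P)
  have part1: "cond_A1 p \<and> cond_A2 D \<Omega> K S \<and> cond_A3 D \<Omega> k \<longrightarrow>
     (\<forall>(M :: 'w measure) R. algorithm_run False P A1 p M R \<longrightarrow>
        (AE w in M. \<forall>x\<in>\<Omega>. (\<lambda>t. post_var k (nvar A1) (run_data R t w) x) \<longlonglongrightarrow> 0)) \<and>
     (\<forall>(M :: 'w measure) R. algorithm_run True P A1 p M R \<longrightarrow>
        (AE w in M. \<exists>t. completes_after P A1 R t w))"
  proof (intro impI conjI allI)
    assume A: "cond_A1 p \<and> cond_A2 D \<Omega> K S \<and> cond_A3 D \<Omega> k"
    then have A1: "cond_A1 p" and A2: "cond_A2 D \<Omega> K S" and A3: "cond_A3 D \<Omega> k" by auto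
    {
      fix M :: "'w measure" and R assume "algorithm_run False P A1 p M R"
      then interpret level_set_run False P A1 p M R "\<sigma>\<^sup>2" by (rule lsr1)
      have "\<exists>q>0. q \<le> 1 \<and> (\<forall>x\<in>cand P. q \<le> hit_prob (nbhd (inputs P) x \<nu>))" if "0 < \<nu>" for \<nu>
        by (intro exI[of _ "?q1 \<nu>"] conjI ballI q1 A2 that)
      then show "AE w in M. \<forall>x\<in>\<Omega>. (\<lambda>t. post_var k (nvar A1) (run_data R t w) x) \<longlonglongrightarrow> 0"
        using AE_post_var_tendsto_0[OF _ A1 _ _ V1, unfolded P] A3 unfolding P by blast
    next
      fix M :: "'w measure" and R assume "algorithm_run True P A1 p M R"
      then interpret level_set_run True P A1 p M R "\<sigma>\<^sup>2" by (rule lsr1)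
      obtain T \<nu> where T: "0 < T" and \<nu>: "0 < \<nu>"
        and small: "\<And>x as. x \<in> \<Omega> \<Longrightarrow> length as = T \<Longrightarrow> set as \<subseteq> nbhd D x \<nu> \<Longrightarrow>
          tuple_var k (\<sigma>\<^sup>2) as x < \<epsilon>\<^sup>2 / \<beta>"
        using tuple_var_small[OF \<open>pos_def_kernel D k\<close> \<open>\<Omega> \<subseteq> D\<close> \<Omega>(1) A3 V1, of "\<epsilon>\<^sup>2 / \<beta>"]
          \<open>\<epsilon> > 0\<close> \<open>\<beta> > 0\<close> by auto
      show "AE w in M. \<exists>t. completes_after P A1 R t w"
        by (rule AE_completes[OF TrueI A1 q1(1)[OF A2 \<nu>] q1(2,3) T]) (simp_all add: P small)
    }
  qed
  {
    fix \<delta> \<nu> :: real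
    assume d: "0 < \<delta>" and rad: "good_radius D \<Omega> k \<beta> \<epsilon> (\<sigma>\<^sup>2) (visits_needed \<beta> (\<sigma>\<^sup>2) \<epsilon>) \<nu>"
    then have \<nu>: "0 < \<nu>" by (simp add: good_radius_def)
    note completion_bounds[where kernel_cont = "cond_A3 D \<Omega> k", OF lsr1 finP p V1 q1(1)[OF _ \<nu>] q1(2,3)
        refl refl rad[folded P] d]
  }
  note bounds1 = this[unfolded P]
  {
    fix \<delta> \<nu> :: real
    assume d: "0 < \<delta>" and rad: "good_radius D \<Omega> k \<beta> \<epsilon> \<sigma>t2 (visits_needed \<beta> \<sigma>t2 \<epsilon>) \<nu>"
    then have \<nu>: "0 < \<nu>" by (simp add: good_radius_def)
    note completion_bounds[where kernel_cont = "cond_A3 D \<Omega> k", OF lsr2 finP p V2 q2(1)[OF _ \<nu>] q2(2,3)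
        refl refl rad[folded P] d]
  }
  note bounds2 = this[unfolded P]
  show ?thesis
    unfolding Let_def
    by (rule conjI[OF part1 conjI]; intro allI impI; elim conjE; rule bounds1 bounds2; assumption)
qed

end
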